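(* Let $M$ be a Hausdorff space and $\mathcal S\to M$ a topologized sheaf of Abelian groups. Let $\mathfrak U=\{U_i\}_{i\in I}$ and $\mathfrak V=\{V_j\}_{j\in J}$ be open covers of $M$ with $\mathfrak V$ finer than $\mathfrak U$, and suppose that for each $p,q\ge0$ the map $$\delta^{q-1}:C^{q-1}(\mathfrak V|\mathfrak U_p,\pi_p^{-1}\mathcal S)\to Z^q(\mathfrak V|\mathfrak U_p,\pi_p^{-1}\mathcal S)$$ is open. Then for $n\ge0$ the refinement homomorphisms $H^n(\mathfrak U,\mathcal S)\to H^n(\mathfrak V,\mathcal S)$ are open. More precisely, for any refinement map $\tau:J\to I$, the homomorphisms $$Z^n(\mathfrak U,\mathcal S)\oplus C^{n-1}(\mathfrak V,\mathcal S)\ni(f,g)\mapsto f|\mathfrak V+\delta_{\mathfrak V}g\in Z^n(\mathfrak V,\mathcal S)$$ are open for $n\ge0$.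
   Context: A sheaf $\mathcal S$ of Abelian groups over a Hausdorff space $M$ is topologized if for every Hausdorff space $U$ and local homeomorphism $\pi:U\to M$ the group $\Gamma(U,\pi^{-1}\mathcal S)$ carries a topology compatible with its group structure, such that for every further local homeomorphism $\rho:V\to U$ the pullback $\rho^*:\Gamma(U,\pi^{-1}\mathcal S)\to\Gamma(V,(\pi\rho)^{-1}\mathcal S)$ is continuous. Then for a local homeomorphism $\pi:U\to M$, the sheaf $\pi^{-1}\mathcal S$ over $U$ is again topologized in the evident way. For an open cover $\mathfrak U=\{U_i\}_{i\in I}$ and $q\ge-1$: for $s=(i_0,\dots,i_q)\in I^{q+1}$, $U_s=U_{i_0}\cap\dots\cap U_{i_q}$ ($I^0=\{\emptyset\}$, $U_\emptyset=M$); $\mathfrak U_q=\coprod_{s\in I^{q+1}}U_s$ with the local homeomorphism $\pi_q:\mathfrak U_q\to M$ restricting to the inclusion on each $U_s$. $C^q(\mathfrak U,\mathcal S)=\prod_{s\in I^{q+1}}\Gamma(U_s,\mathcal S)$ (not necessarily alternating cochains) carries the topology transported from $\Gamma(\mathfrak U_q,\pi_q^{-1}\mathcal S)$ via $f\mapsto(f|U_s)_s$. The Čech differential is $(\delta f)_{i_0\dots i_{q+1}}=\sum_{k=0}^{q+1}(-1)^kf_{i_0\dots\hat i_k\dots i_{q+1}}|U_{i_0\dots i_{q+1}}$ for $q\ge0$, and $\delta^{-1}:\Gamma(M,\mathcal S)\to C^0$ is $f\mapsto(f|U_i)_i$. $Z^q=\ker\delta^q$ with subspace topology; $H^0=Z^0$,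 $H^q=Z^q/\mathrm{Im}\,\delta^{q-1}$ with quotient topology. $\mathfrak V|\mathfrak U_p$ denotes the open cover $\{\pi_p^{-1}V_j\}_{j\in J}$ of $\mathfrak U_p$. A refinement map $\tau:J\to I$ satisfies $V_j\subset U_{\tau(j)}$ and induces $(f|\mathfrak V)_{j_0\dots j_n}=f_{\tau(j_0)\dots\tau(j_n)}|V_{j_0\dots j_n}$. *)

theory Defs
  imports "HOL-Analysis.Analysis"
begin

definition local_homeo :: "'a topology \<Rightarrow> 'b topology \<Rightarrow> ('a \<Rightarrow> 'b) \<Rightarrow> bool" where
  "local_homeo X Y f \<longleftrightarrow> continuous_map X Y f \<and>
     (\<forall>x\<in>topspace X. \<exists>W. openin X W \<and> x \<in> W \<and> openin Y (f ` W) \<and>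
        homeomorphic_map (subtopology X W) (subtopology Y (f ` W)) f)"

record ('a, 'e) ab_sheaf =
  base  :: "'a topology"
  etale :: "'e topology"
  proj  :: "'e \<Rightarrow> 'a"
  sadd  :: "'e \<Rightarrow> 'e \<Rightarrow> 'e"
  szero :: "'a \<Rightarrow> 'e"
  sneg  :: "'e \<Rightarrow> 'e"

definition is_ab_sheaf :: "('a, 'e) ab_sheaf \<Rightarrow> bool" where
  "is_ab_sheaf S \<longleftrightarrow>
     local_homeo (etale S) (base S) (proj S) \<and>
     (\<forall>x\<in>topspace (base S). szero S x \<in> topspace (etale S) \<and> proj S (szero S x) = x) \<and>
     continuous_map (base S) (etale S) (szero S) \<and>
     (\<forall>e\<in>topspace (etale S). \<forall>e'\<in>topspace (etale S). proj S e = proj S e' \<longrightarrow>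
         sadd S e e' \<in> topspace (etale S) \<and> proj S (sadd S e e') = proj S e) \<and>
     continuous_map
       (subtopology (prod_topology (etale S) (etale S)) {(e, e'). proj S e = proj S e'})
       (etale S) (\<lambda>(e, e'). sadd S e e') \<and>
     (\<forall>e\<in>topspace (etale S). sneg S e \<in> topspace (etale S) \<and> proj S (sneg S e) = proj S e) \<and>
     continuous_map (etale S) (etale S) (sneg S) \<and>
     (\<forall>e\<in>topspace (etale S). \<forall>e'\<in>topspace (etale S). \<forall>e''\<in>topspace (etale S).
        proj S e = proj S e' \<and> proj S e' = proj S e'' \<longrightarrow>
          sadd S (sadd S e e') e'' = sadd S e (sadd S e' e'') \<and>
          sadd S e e' = sadd S e' e) \<and>
     (\<forall>e\<in>topspace (etale S). sadd S (szero S (proj S e)) e = e \<and>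
          sadd S (sneg S e) e = szero S (proj S e))"

text \<open>Sections of the pullback of S along pi over X: continuous lifts of pi,
  normalised to be undefined outside the carrier of X.\<close>

definition sect :: "('a, 'e) ab_sheaf \<Rightarrow> 'u topology \<Rightarrow> ('u \<Rightarrow> 'a) \<Rightarrow> ('u \<Rightarrow> 'e) set" where
  "sect S X \<pi> = {s. s \<in> extensional (topspace X) \<and> continuous_map X (etale S) s \<and>
                    (\<forall>u\<in>topspace X. proj S (s u) = \<pi> u)}"

definition sec_add :: "('a, 'e) ab_sheaf \<Rightarrow> 'u topology \<Rightarrow> ('u \<Rightarrow> 'e) \<Rightarrow> ('u \<Rightarrow> 'e) \<Rightarrow> 'u \<Rightarrow> 'e" where
  "sec_add S X s s' = (\<lambda>u. if u \<in> topspace X then sadd S (s u) (s' u) else undefined)"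

definition sec_neg :: "('a, 'e) ab_sheaf \<Rightarrow> 'u topology \<Rightarrow> ('u \<Rightarrow> 'e) \<Rightarrow> 'u \<Rightarrow> 'e" where
  "sec_neg S X s = (\<lambda>u. if u \<in> topspace X then sneg S (s u) else undefined)"

definition sec_zero :: "('a, 'e) ab_sheaf \<Rightarrow> 'u topology \<Rightarrow> ('u \<Rightarrow> 'a) \<Rightarrow> 'u \<Rightarrow> 'e" where
  "sec_zero S X \<pi> = (\<lambda>u. if u \<in> topspace X then szero S (\<pi> u) else undefined)"

text \<open>T X pi is the topology on the group of sections of the pullback of S along
  the local homeomorphism pi : X \<rightarrow> M.  Spaces X range over all Hausdorff spaces
  whose points lie in the (arbitrary) type 'u.\<close>

definition topologized ::
  "('a, 'e) ab_sheaf \<Rightarrow> ('u topology \<Rightarrow> ('u \<Rightarrow> 'a) \<Rightarrow> ('u \<Rightarrow> 'e) topology) \<Rightarrow> bool" where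
  "topologized S T \<longleftrightarrow>
     (\<forall>X \<pi>. Hausdorff_space X \<and> local_homeo X (base S) \<pi> \<longrightarrow>
        topspace (T X \<pi>) = sect S X \<pi> \<and>
        continuous_map (prod_topology (T X \<pi>) (T X \<pi>)) (T X \<pi>) (\<lambda>(s, s'). sec_add S X s s') \<and>
        continuous_map (T X \<pi>) (T X \<pi>) (sec_neg S X) \<and>
        (\<forall>Y \<rho>. Hausdorff_space Y \<and> local_homeo Y X \<rho> \<longrightarrow>
           continuous_map (T X \<pi>) (T Y (\<pi> \<circ> \<rho>)) (\<lambda>s. restrict (s \<circ> \<rho>) (topspace Y))))"

definition open_cover :: "'a topology \<Rightarrow> 'i set \<Rightarrow> ('i \<Rightarrow> 'a set) \<Rightarrow> bool" where
  "open_cover M I U \<longleftrightarrow> (\<forall>i\<in>I. openin M (U i)) \<and> (\<Union>i\<in>I. U i) = topspace M"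

text \<open>U_s for a tuple s (as a list); the empty tuple gives M.\<close>
definition isect :: "'a topology \<Rightarrow> ('i \<Rightarrow> 'a set) \<Rightarrow> 'i list \<Rightarrow> 'a set" where
  "isect M U s = topspace M \<inter> (\<Inter>i\<in>set s. U i)"

text \<open>cech_space M I U J V a b is the disjoint union over s in I^a, t in J^b of
  U_s \<inter> V_t.  With a = p+1, b = q+1 this is (V|U_p)_q; with b = 0 it is U_(a-1);
  with a = 0 it is V_(b-1).  The projection to M is snd.\<close>
definition cech_space ::
  "'a topology \<Rightarrow> 'i set \<Rightarrow> ('i \<Rightarrow> 'a set) \<Rightarrow> 'j set \<Rightarrow> ('j \<Rightarrow> 'a set) \<Rightarrow> nat \<Rightarrow> nat
     \<Rightarrow> (('i list \<times> 'j list) \<times> 'a) topology" where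
  "cech_space M I U J V a b =
     sum_topology (\<lambda>(s, t). subtopology M (isect M U s \<inter> isect M V t))
       {(s, t). set s \<subseteq> I \<and> length s = a \<and> set t \<subseteq> J \<and> length t = b}"

definition del_at :: "nat \<Rightarrow> 'x list \<Rightarrow> 'x list" where
  "del_at m xs = take m xs @ drop (Suc m) xs"

definition signed :: "('a, 'e) ab_sheaf \<Rightarrow> nat \<Rightarrow> 'e \<Rightarrow> 'e" where
  "signed S m e = (if even m then e else sneg S e)"

definition fsum :: "('a, 'e) ab_sheaf \<Rightarrow> 'a \<Rightarrow> 'e list \<Rightarrow> 'e" where
  "fsum S x es = foldr (sadd S) es (szero S x)"

definition dT :: "('a, 'e) ab_sheaf \<Rightarrow> (('i list \<times> 'j list) \<times> 'a) topology
     \<Rightarrow> ((('i list \<times> 'j list) \<times> 'a) \<Rightarrow> 'e) \<Rightarrow> (('i list \<times> 'j list) \<times> 'a) \<Rightarrow> 'e" where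
  "dT S Xt f = (\<lambda>((s, t), x). if ((s, t), x) \<in> topspace Xt
      then fsum S x (map (\<lambda>m. signed S m (f ((s, del_at m t), x))) [0..<length t])
      else undefined)"

definition dS :: "('a, 'e) ab_sheaf \<Rightarrow> (('i list \<times> 'j list) \<times> 'a) topology
     \<Rightarrow> ((('i list \<times> 'j list) \<times> 'a) \<Rightarrow> 'e) \<Rightarrow> (('i list \<times> 'j list) \<times> 'a) \<Rightarrow> 'e" where
  "dS S Xt f = (\<lambda>((s, t), x). if ((s, t), x) \<in> topspace Xt
      then fsum S x (map (\<lambda>m. signed S m (f ((del_at m s, t), x))) [0..<length s])
      else undefined)"

text \<open>Cocycles w.r.t. the J-differential at level (a,b), i.e. Z^(b-1).\<close>
definition ZT ::
  "('a, 'e) ab_sheaf \<Rightarrow> 'i set \<Rightarrow> ('i \<Rightarrow> 'a set) \<Rightarrow> 'j set \<Rightarrow> ('j \<Rightarrow> 'a set) \<Rightarrow> nat \<Rightarrow> nat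
     \<Rightarrow> ((('i list \<times> 'j list) \<times> 'a) \<Rightarrow> 'e) set" where
  "ZT S I U J V a b =
     {f \<in> sect S (cech_space (base S) I U J V a b) snd.
        dT S (cech_space (base S) I U J V a (Suc b)) f
          = sec_zero S (cech_space (base S) I U J V a (Suc b)) snd}"

text \<open>Cocycles w.r.t. the I-differential at level (a,b), i.e. Z^(a-1).\<close>
definition ZS ::
  "('a, 'e) ab_sheaf \<Rightarrow> 'i set \<Rightarrow> ('i \<Rightarrow> 'a set) \<Rightarrow> 'j set \<Rightarrow> ('j \<Rightarrow> 'a set) \<Rightarrow> nat \<Rightarrow> nat
     \<Rightarrow> ((('i list \<times> 'j list) \<times> 'a) \<Rightarrow> 'e) set" where
  "ZS S I U J V a b =
     {f \<in> sect S (cech_space (base S) I U J V a b) snd.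
        dS S (cech_space (base S) I U J V (Suc a) b) f
          = sec_zero S (cech_space (base S) I U J V (Suc a) b) snd}"

text \<open>Refinement f |-> f|V along tau, from level (a,0) to level (0,a).\<close>
definition refine :: "('j \<Rightarrow> 'i) \<Rightarrow> (('i list \<times> 'j list) \<times> 'a) topology
     \<Rightarrow> ((('i list \<times> 'j list) \<times> 'a) \<Rightarrow> 'e) \<Rightarrow> (('i list \<times> 'j list) \<times> 'a) \<Rightarrow> 'e" where
  "refine \<tau> Xt f = (\<lambda>((s, t), x). if ((s, t), x) \<in> topspace Xt then f ((map \<tau> t, []), x) else undefined)"

end

theory Submission
  imports Defs "HOL-Algebra.Group"
begin

text \<open>
  Sections over the spaces \<open>U\<^sub>s \<inter> V\<^sub>t\<close> form a double complex \<open>C a b\<close>, augmented in both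
  directions. A small cocycle \<open>z\<close> of \<open>C 0 (n + 1)\<close> is pushed along a zigzag: the openness hypothesis
  yields small \<open>h\<^sub>1\<close> with \<open>dT h\<^sub>1 = dS z\<close>, then small \<open>h\<^sub>k\<^sub>+\<^sub>1\<close> with \<open>dT h\<^sub>k\<^sub>+\<^sub>1 = dS h\<^sub>k\<close>, down to
  a \<open>dS\<close>-cocycle \<open>h\<^sub>n\<^sub>+\<^sub>1\<close> in \<open>C (n + 1) 0\<close>. The Alexander--Whitney maps
  \<open>(P\<^sub>k h)(t) = h (\<tau> t\<^sub>0, \<dots>, \<tau> t\<^sub>k\<^sub>-\<^sub>1; t\<^sub>k\<^sub>-\<^sub>1, t\<^sub>k, \<dots>)\<close> are continuous, being pullbacks, and satisfy
  \<open>dT (P\<^sub>k h) = P\<^sub>k\<^sub>+\<^sub>1 (dS h) + (-1)\<^sup>k\<^sup>-\<^sup>1 P\<^sub>k (dT h)\<close>. Since \<open>P\<^sub>1 (dS z) = z\<close> and \<open>P\<^sub>n\<^sub>+\<^sub>1 (dT h\<^sub>n\<^sub>+\<^sub>1)\<close> is the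
  refinement of \<open>h\<^sub>n\<^sub>+\<^sub>1\<close>, telescoping writes \<open>z\<close> as the refinement of a small cocycle plus the
  coboundary of a small cochain.
\<close>

section \<open>Alternating face sums in a commutative group\<close>

text \<open>The index is shifted: \<open>aw \<tau> k\<close> is \<open>P\<^sub>k\<^sub>+\<^sub>1\<close>.\<close>

definition aw :: "('j \<Rightarrow> 'i) \<Rightarrow> nat \<Rightarrow> ('i list \<Rightarrow> 'j list \<Rightarrow> 'a) \<Rightarrow> 'j list \<Rightarrow> 'a" where
  "aw \<tau> k h t = h (map \<tau> (take (Suc k) t)) (drop k t)"

lemma aw_Suc_Cons: "aw \<tau> (Suc k) h (j # t) = aw \<tau> k (\<lambda>s. h (\<tau> j # s)) t"
  by (simp add: aw_def)

context comm_group
begin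

text \<open>The alternating face sum in multiplicative notation: deleting the head gives
  \<open>\<phi> s\<close>, while deleting a later entry keeps \<open>i\<close> and shifts the
  position by one, whence the inverse. This form admits structural induction, which the indexed sum
  does not.\<close>

fun cdiff :: "('l list \<Rightarrow> 'a) \<Rightarrow> 'l list \<Rightarrow> 'a" where
  "cdiff \<phi> [] = \<one>"
| "cdiff \<phi> (i # s) = \<phi> s \<otimes> inv (cdiff (\<lambda>s. \<phi> (i # s)) s)"

lemma cdiff_closed [simp, intro]:
  "(\<And>s. \<phi> s \<in> carrier G) \<Longrightarrow> cdiff \<phi> s \<in> carrier G"
  by (induction s arbitrary: \<phi>) auto

text \<open>Only the faces of \<open>s\<close> enter the sum. Cochains are later extended by zero to
  all lists, and this lemma allows their values at lists that are not faces to be ignored.\<close>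

lemma cdiff_cong:
  assumes "\<And>s'. set s' \<subseteq> set s \<Longrightarrow> Suc (length s') = length s \<Longrightarrow> \<phi> s' = \<psi> s'"
  shows "cdiff \<phi> s = cdiff \<psi> s"
  using assms
proof (induction s arbitrary: \<phi> \<psi>)
  case (Cons i s)
  have "cdiff (\<lambda>s. \<phi> (i # s)) s = cdiff (\<lambda>s. \<psi> (i # s)) s"
    by (rule Cons.IH, rule Cons.prems) auto
  moreover have "\<phi> s = \<psi> s"
    by (rule Cons.prems) auto
  ultimately show ?case by simp
qed simp

lemma cdiff_mult:
  assumes "\<And>s. \<phi> s \<in> carrier G" "\<And>s. \<psi> s \<in> carrier G"
  shows "cdiff (\<lambda>s. \<phi> s \<otimes> \<psi> s) s = cdiff \<phi> s \<otimes> cdiff \<psi> s"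
  using assms by (induction s arbitrary: \<phi> \<psi>) (simp_all add: inv_mult m_ac)

lemma cdiff_inv:
  assumes "\<And>s. \<phi> s \<in> carrier G"
  shows "cdiff (\<lambda>s. inv (\<phi> s)) s = inv (cdiff \<phi> s)"
  using assms by (induction s arbitrary: \<phi>) (simp_all add: inv_mult)

text \<open>Unfolding at \<open>i # s\<close> gives \<open>cdiff \<phi> s\<close> divided by the
  face sum of a quotient. By additivity \<open>cdiff \<phi> s\<close> cancels, and what remains is
  the double face sum of the family with \<open>i\<close> fixed in front, trivial by
  induction.\<close>

lemma cdiff_cdiff:
  assumes "\<And>s. \<phi> s \<in> carrier G"
  shows "cdiff (cdiff \<phi>) s = \<one>"
  using assms
proof (induction s arbitrary: \<phi>)
  case (Cons i s)
  then show ?case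
    by (simp add: cdiff_mult cdiff_inv)
qed simp

lemma cdiff_commute:
  assumes "\<And>s t. \<phi> s t \<in> carrier G"
  shows "cdiff (\<lambda>s. cdiff (\<phi> s) t) s = cdiff (\<lambda>t. cdiff (\<lambda>s. \<phi> s t) s) t"
  using assms
proof (induction s arbitrary: \<phi>)
  case Nil
  \<comment> \<open>Additivity gives \<open>x = x \<otimes> x\<close> for the face sum
    \<open>x\<close> of the constant family \<open>\<one>\<close>, so \<open>x\<close> is
    trivial.\<close>
  show ?case using cdiff_mult[of "\<lambda>_. \<one>" "\<lambda>_. \<one>" t] by simp
next
  case (Cons i s)
  then show ?case
    by (simp add: cdiff_mult cdiff_inv)
qed

lemma cdiff_map: "cdiff \<phi> (map \<tau> t) = cdiff (\<lambda>t. \<phi> (map \<tau> t)) t"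
  by (induction t arbitrary: \<phi>) simp_all

text \<open>Deleting an entry of \<open>t\<close> at position at most \<open>k\<close> deletes one
  from the front piece of \<open>aw \<tau> (Suc k)\<close>; deleting a later one deletes from the
  back piece of \<open>aw \<tau> k\<close>, with positions shifted by \<open>k\<close>, whence the
  sign. The right-hand side has two further terms, the last front face and the first back face. Both
  are \<open>h\<close> at \<open>map \<tau> (take (Suc k) t)\<close> and
  \<open>drop (Suc k) t\<close>, with opposite signs, and cancel.\<close>

lemma cdiff_aw:
  assumes "\<And>s t. h s t \<in> carrier G" "Suc k < length t"
  shows "cdiff (aw \<tau> k h) t =
    aw \<tau> (Suc k) (\<lambda>s t. cdiff (\<lambda>s. h s t) s) t \<otimes>
    (if even k then aw \<tau> k (\<lambda>s. cdiff (h s)) t else inv (aw \<tau> k (\<lambda>s. cdiff (h s)) t))"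
  using assms
proof (induction k arbitrary: h t)
  case 0
  obtain j j' t' where t: "t = j # j' # t'"
    \<comment> \<open>The rule serves only to split lists into empty, one-element and longer
      ones.\<close>
    using 0(2) by (cases t rule: remdups_adj.cases) auto
  show ?case
    using 0(1) by (simp add: t aw_def inv_mult m_ac) (simp add: m_assoc[symmetric])
next
  case (Suc k)
  obtain j t' where t: "t = j # t'" and l: "Suc k < length t'"
    using Suc.prems(2) by (cases t) auto
  \<comment> \<open>Peeling off \<open>j\<close> reduces to level \<open>k\<close> for the family
    with \<open>\<tau> j\<close> fixed in front; the inverse accounts for the change of parity from
    \<open>k\<close> to \<open>Suc k\<close>.\<close>
  have "cdiff (aw \<tau> (Suc k) h) t = aw \<tau> (Suc k) h t' \<otimes> inv (cdiff (aw \<tau> k (\<lambda>s. h (\<tau> j # s))) t')"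
    by (simp add: t aw_Suc_Cons)
  then show ?case
    using Suc.prems(1) l
    by (simp add: Suc.IH) (simp add: t aw_Suc_Cons aw_def inv_mult m_assoc)
qed

text \<open>Connects the indexed sums in the definitions of the differentials with
  \<open>cdiff\<close>. Shifting the index past the head flips every sign, and a sum of inverted
  terms is the inverse of the sum.\<close>

lemma foldr_cdiff:
  assumes "\<And>s. \<phi> s \<in> carrier G"
  shows "foldr (\<otimes>) (map (\<lambda>m. if even m then \<phi> (del_at m s) else inv (\<phi> (del_at m s))) [0..<length s]) \<one>
    = cdiff \<phi> s"
  using assms
proof (induction s arbitrary: \<phi>)
  case (Cons i s)
  have fc: "foldr (\<otimes>) (map f ms) \<one> \<in> carrier G \<and>
      foldr (\<otimes>) (map (\<lambda>m. inv (f m)) ms) \<one> = inv (foldr (\<otimes>) (map f ms) \<one>)"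
    if "\<And>m. f m \<in> carrier G" for f and ms :: "nat list"
    using that by (induction ms) (simp_all add: inv_mult)
  let ?f = "\<lambda>m. if even m then \<phi> (i # del_at m s) else inv (\<phi> (i # del_at m s))"
  have f: "?f m \<in> carrier G" for m
    using Cons.prems by simp
  have "map (\<lambda>m. if even m then \<phi> (del_at m (i # s)) else inv (\<phi> (del_at m (i # s)))) [0..<length (i # s)]
    = \<phi> s # map (\<lambda>m. inv (?f m)) [0..<length s]"
    using Cons.prems
    by (simp add: upt_conv_Cons map_Suc_upt[symmetric] del_at_def del: upt_Suc)
  then show ?case
    using fc[of ?f, OF f] Cons.IH[of "\<lambda>s. \<phi> (i # s)"] Cons.prems by simp
qed simp

end

section \<open>Double complexes of topological groups\<close>

definition top_ab_group :: "'g monoid \<Rightarrow> 'g topology \<Rightarrow> bool" where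
  "top_ab_group G T \<longleftrightarrow> comm_group G \<and> topspace T = carrier G \<and>
     continuous_map (prod_topology T T) T (\<lambda>(x, y). x \<otimes>\<^bsub>G\<^esub> y) \<and>
     continuous_map T T (m_inv G)"

lemma top_ab_group_translate:
  assumes "top_ab_group G T" "z \<in> carrier G"
  shows "continuous_map T T (\<lambda>x. z \<otimes>\<^bsub>G\<^esub> x)"
proof -
  have "continuous_map T (prod_topology T T) (\<lambda>x. (z, x))"
    using assms by (simp add: continuous_map_paired top_ab_group_def)
  from continuous_map_compose[OF this] show ?thesis
    using assms by (fastforce simp: top_ab_group_def o_def)
qed

text \<open>Continuity of division at the pair of identities. Each zigzag step divides one small
  cochain by another and must stay inside a prescribed neighbourhood.\<close>

lemma top_ab_group_diff_nbhd:
  assumes "top_ab_group G T" "openin T B" "\<one>\<^bsub>G\<^esub> \<in> B"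
  obtains B' where "openin T B'" "\<one>\<^bsub>G\<^esub> \<in> B'" "\<And>p q. p \<in> B' \<Longrightarrow> q \<in> B' \<Longrightarrow> p \<otimes>\<^bsub>G\<^esub> inv\<^bsub>G\<^esub> q \<in> B"
proof -
  interpret comm_group G using assms(1) by (simp add: top_ab_group_def)
  have ts: "topspace T = carrier G" using assms(1) by (simp add: top_ab_group_def)
  have "continuous_map (prod_topology T T) T (\<lambda>x. inv\<^bsub>G\<^esub> (snd x))"
    using continuous_map_compose[OF continuous_map_snd, of T T "m_inv G" T] assms(1)
    by (simp add: top_ab_group_def o_def)
  then have "continuous_map (prod_topology T T) (prod_topology T T) (\<lambda>x. (fst x, inv\<^bsub>G\<^esub> (snd x)))"
    by (simp add: continuous_map_paired continuous_map_fst)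
  from continuous_map_compose[OF this] have "continuous_map (prod_topology T T) T (\<lambda>x. fst x \<otimes>\<^bsub>G\<^esub> inv\<^bsub>G\<^esub> (snd x))"
    using assms(1) by (fastforce simp: top_ab_group_def o_def)
  then have "openin (prod_topology T T)
      {x \<in> topspace (prod_topology T T). fst x \<otimes>\<^bsub>G\<^esub> inv\<^bsub>G\<^esub> (snd x) \<in> B}" (is "openin _ ?E")
    using assms(2) by (rule openin_continuous_map_preimage)
  moreover have "(\<one>\<^bsub>G\<^esub>, \<one>\<^bsub>G\<^esub>) \<in> ?E" using assms(3) by (simp add: ts)
  ultimately obtain P Q where PQ: "openin T P" "openin T Q" "\<one>\<^bsub>G\<^esub> \<in> P" "\<one>\<^bsub>G\<^esub> \<in> Q" "P \<times> Q \<subseteq> ?E"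
    unfolding openin_prod_topology_alt by meson
  show thesis
    by (rule that[of "P \<inter> Q"]) (use PQ in auto)
qed

text \<open>This lemma and the next isolate \<open>q\<close> in the Alexander--Whitney identity, one
  for each sign. The bracketed products containing \<open>q\<close> stand for the coboundary of
  \<open>P k b h\<close>, with \<open>r\<close> the refined cocycle and \<open>g\<close> the
  coboundary already found.\<close>

lemma (in comm_group) solve_right_factor:
  assumes "r \<in> carrier G" "g \<in> carrier G" "q \<in> carrier G"
  shows "inv r \<otimes> (r \<otimes> g \<otimes> q \<otimes> inv g) = q"
proof -
  have "inv r \<otimes> (r \<otimes> g \<otimes> q \<otimes> inv g) = (inv r \<otimes> r) \<otimes> (g \<otimes> inv g) \<otimes> q"
    using assms by (simp only: m_ac inv_closed m_closed)
  then show ?thesis using assms by simp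
qed

lemma (in comm_group) solve_inv_right_factor:
  assumes "r \<in> carrier G" "g \<in> carrier G" "q \<in> carrier G"
  shows "r \<otimes> (g \<otimes> inv (r \<otimes> g \<otimes> inv q)) = q"
proof -
  have "r \<otimes> (g \<otimes> inv (r \<otimes> g \<otimes> inv q)) = (r \<otimes> g) \<otimes> inv (r \<otimes> g) \<otimes> q"
    using assms by (simp add: inv_mult m_assoc)
  then show ?thesis using assms by simp
qed

text \<open>Degrees are shifted by one, so that index 0 is the augmentation: \<open>C a 0\<close>
  and \<open>C 0 b\<close> hold the cochains of the two covers, and \<open>R\<close> compares them.
  The two differentials commute rather than anticommute. \<open>P k b\<close> starts from positive
  degrees because its front and back pieces share an entry. \<open>dT_open\<close> speaks of the
  rows \<open>Suc p\<close>, whereas the openness to be proved lives in row 0.\<close>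

locale augmented_double_complex =
  fixes C :: "nat \<Rightarrow> nat \<Rightarrow> 'c monoid"
    and Top :: "nat \<Rightarrow> nat \<Rightarrow> 'c topology"
    and dT dS P :: "nat \<Rightarrow> nat \<Rightarrow> 'c \<Rightarrow> 'c"
    and R :: "nat \<Rightarrow> 'c \<Rightarrow> 'c"
  assumes tg: "top_ab_group (C a b) (Top a b)"
    and dT_hom: "dT a b \<in> hom (C a b) (C a (Suc b))"
    and dS_hom: "dS a b \<in> hom (C a b) (C (Suc a) b)"
    and R_hom: "R a \<in> hom (C a 0) (C 0 a)"
    and P_hom: "P k b \<in> hom (C (Suc k) (Suc b)) (C 0 (Suc (k + b)))"
    and dS_cont: "continuous_map (Top a b) (Top (Suc a) b) (dS a b)"
    and P_cont: "continuous_map (Top (Suc k) (Suc b)) (Top 0 (Suc (k + b))) (P k b)"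
    and dT_dT: "x \<in> carrier (C a b) \<Longrightarrow> dT a (Suc b) (dT a b x) = \<one>\<^bsub>C a (Suc (Suc b))\<^esub>"
    and dS_dS: "x \<in> carrier (C a b) \<Longrightarrow> dS (Suc a) b (dS a b x) = \<one>\<^bsub>C (Suc (Suc a)) b\<^esub>"
    and dT_dS: "x \<in> carrier (C a b) \<Longrightarrow> dT (Suc a) b (dS a b x) = dS a (Suc b) (dT a b x)"
    and dT_R: "x \<in> carrier (C a 0) \<Longrightarrow> dT 0 a (R a x) = R (Suc a) (dS a 0 x)"
    and P_dT_0: "x \<in> carrier (C (Suc k) 0) \<Longrightarrow> P k 0 (dT (Suc k) 0 x) = R (Suc k) x"
    and P_0_dS: "x \<in> carrier (C 0 (Suc b)) \<Longrightarrow> P 0 b (dS 0 (Suc b) x) = x"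
    and dT_P: "x \<in> carrier (C (Suc k) (Suc b)) \<Longrightarrow>
      dT 0 (Suc (k + b)) (P k b x) =
        P (Suc k) b (dS (Suc k) (Suc b) x) \<otimes>\<^bsub>C 0 (Suc (Suc (k + b)))\<^esub>
        (if even k then P k (Suc b) (dT (Suc k) (Suc b) x)
         else inv\<^bsub>C 0 (Suc (Suc (k + b)))\<^esub> (P k (Suc b) (dT (Suc k) (Suc b) x)))"
    and dT_inj: "x \<in> carrier (C (Suc a) 0) \<Longrightarrow> dT (Suc a) 0 x = \<one>\<^bsub>C (Suc a) (Suc 0)\<^esub> \<Longrightarrow> x = \<one>\<^bsub>C (Suc a) 0\<^esub>"
    and dT_open: "open_map (Top (Suc p) q)
      (subtopology (Top (Suc p) (Suc q))
        {x \<in> carrier (C (Suc p) (Suc q)). dT (Suc p) (Suc q) x = \<one>\<^bsub>C (Suc p) (Suc (Suc q))\<^esub>})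
      (dT (Suc p) q)"
begin

section \<open>Closure and homomorphism rules for the maps of the complex\<close>

lemma comm_group_C: "comm_group (C a b)"
  using tg by (simp add: top_ab_group_def)

lemma group_C: "group (C a b)"
  using comm_group_C by (simp add: comm_group_def)

lemma topspace_Top [simp]: "topspace (Top a b) = carrier (C a b)"
  using tg by (simp add: top_ab_group_def)

lemma open_carrier: "openin (Top a b) A \<Longrightarrow> x \<in> A \<Longrightarrow> x \<in> carrier (C a b)"
  using openin_subset by fastforce

lemma C_closed [simp]:
  "\<one>\<^bsub>C a b\<^esub> \<in> carrier (C a b)"
  "x \<in> carrier (C a b) \<Longrightarrow> inv\<^bsub>C a b\<^esub> x \<in> carrier (C a b)"
  "x \<in> carrier (C a b) \<Longrightarrow> y \<in> carrier (C a b) \<Longrightarrow> x \<otimes>\<^bsub>C a b\<^esub> y \<in> carrier (C a b)"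
  using group_C by (simp_all add: group.is_monoid monoid.m_closed)

lemma maps_closed [simp]:
  "x \<in> carrier (C a b) \<Longrightarrow> dT a b x \<in> carrier (C a (Suc b))"
  "x \<in> carrier (C a b) \<Longrightarrow> dS a b x \<in> carrier (C (Suc a) b)"
  "x \<in> carrier (C a 0) \<Longrightarrow> R a x \<in> carrier (C 0 a)"
  "x \<in> carrier (C (Suc k) (Suc b)) \<Longrightarrow> P k b x \<in> carrier (C 0 (Suc (k + b)))"
  by (fact hom_in_carrier[OF dT_hom] hom_in_carrier[OF dS_hom] hom_in_carrier[OF R_hom] hom_in_carrier[OF P_hom])+

lemma maps_one [simp]:
  "dT a b \<one>\<^bsub>C a b\<^esub> = \<one>\<^bsub>C a (Suc b)\<^esub>"
  "dS a b \<one>\<^bsub>C a b\<^esub> = \<one>\<^bsub>C (Suc a) b\<^esub>"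
  "R a \<one>\<^bsub>C a 0\<^esub> = \<one>\<^bsub>C 0 a\<^esub>"
  "P k b \<one>\<^bsub>C (Suc k) (Suc b)\<^esub> = \<one>\<^bsub>C 0 (Suc (k + b))\<^esub>"
  using dT_hom dS_hom R_hom P_hom group_C by (blast intro: hom_one)+

lemma maps_mult:
  "x \<in> carrier (C a b) \<Longrightarrow> y \<in> carrier (C a b) \<Longrightarrow> dT a b (x \<otimes>\<^bsub>C a b\<^esub> y) = dT a b x \<otimes>\<^bsub>C a (Suc b)\<^esub> dT a b y"
  "x \<in> carrier (C a b) \<Longrightarrow> y \<in> carrier (C a b) \<Longrightarrow> dS a b (x \<otimes>\<^bsub>C a b\<^esub> y) = dS a b x \<otimes>\<^bsub>C (Suc a) b\<^esub> dS a b y"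
  "x \<in> carrier (C a 0) \<Longrightarrow> y \<in> carrier (C a 0) \<Longrightarrow> R a (x \<otimes>\<^bsub>C a 0\<^esub> y) = R a x \<otimes>\<^bsub>C 0 a\<^esub> R a y"
  using dT_hom dS_hom R_hom by (auto simp: hom_mult)

lemma maps_inv:
  "x \<in> carrier (C a b) \<Longrightarrow> dT a b (inv\<^bsub>C a b\<^esub> x) = inv\<^bsub>C a (Suc b)\<^esub> (dT a b x)"
  "x \<in> carrier (C a b) \<Longrightarrow> dS a b (inv\<^bsub>C a b\<^esub> x) = inv\<^bsub>C (Suc a) b\<^esub> (dS a b x)"
  "x \<in> carrier (C a 0) \<Longrightarrow> R a (inv\<^bsub>C a 0\<^esub> x) = inv\<^bsub>C 0 a\<^esub> (R a x)"
  using group_hom.hom_inv[of "C a b" "C a (Suc b)" "dT a b"] group_hom.hom_inv[of "C a b" "C (Suc a) b" "dS a b"]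
    group_hom.hom_inv[of "C a 0" "C 0 a" "R a"] dT_hom dS_hom R_hom group_C
  by (auto simp: group_hom_def group_hom_axioms_def)

text \<open>The form in which openness is used: a cocycle close enough to the identity has a
  primitive in a prescribed neighbourhood. Exactness is not assumed; cocycles far from the identity
  may have no primitive.\<close>

lemma dT_preimage_nbhd:
  assumes "openin (Top (Suc p) q) W" "\<one>\<^bsub>C (Suc p) q\<^esub> \<in> W"
  obtains W' where "openin (Top (Suc p) (Suc q)) W'" "\<one>\<^bsub>C (Suc p) (Suc q)\<^esub> \<in> W'"
    "\<And>y. y \<in> W' \<Longrightarrow> dT (Suc p) (Suc q) y = \<one>\<^bsub>C (Suc p) (Suc (Suc q))\<^esub> \<Longrightarrow> \<exists>x\<in>W. dT (Suc p) q x = y"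
proof -
  obtain W' where W': "openin (Top (Suc p) (Suc q)) W'"
    "dT (Suc p) q ` W = W' \<inter> {x \<in> carrier (C (Suc p) (Suc q)). dT (Suc p) (Suc q) x = \<one>\<^bsub>C (Suc p) (Suc (Suc q))\<^esub>}"
    using dT_open assms(1) unfolding open_map_def openin_subtopology by meson
  show thesis
  proof (rule that[OF W'(1)])
    show "\<one>\<^bsub>C (Suc p) (Suc q)\<^esub> \<in> W'"
      using W'(2) assms(2) maps_one(1)[of "Suc p" q] by (metis IntD1 imageI)
    show "\<exists>x\<in>W. dT (Suc p) q x = y"
      if "y \<in> W'" "dT (Suc p) (Suc q) y = \<one>\<^bsub>C (Suc p) (Suc (Suc q))\<^esub>" for y
    proof -
      have "y \<in> dT (Suc p) q ` W"
        unfolding W'(2) using that open_carrier[OF W'(1)] by simp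
      then show ?thesis by blast
    qed
  qed
qed

text \<open>The zigzag: lifting \<open>dS h\<close> along \<open>dT\<close> raises the first degree and lowers the second, and
  the Alexander--Whitney identity records the correction as a \<open>dT\<close>-coboundary.\<close>

lemma small_zigzag:
  assumes "openin (Top (Suc (k + b)) 0) A" "\<one>\<^bsub>C (Suc (k + b)) 0\<^esub> \<in> A"
    and "openin (Top 0 (k + b)) B" "\<one>\<^bsub>C 0 (k + b)\<^esub> \<in> B"
  shows "\<exists>W. openin (Top (Suc k) b) W \<and> \<one>\<^bsub>C (Suc k) b\<^esub> \<in> W \<and>
    (\<forall>h\<in>W. dT (Suc (Suc k)) b (dS (Suc k) b h) = \<one>\<^bsub>C (Suc (Suc k)) (Suc b)\<^esub> \<longrightarrow>
      (\<exists>f\<in>A. \<exists>g\<in>B. dS (Suc (k + b)) 0 f = \<one>\<^bsub>C (Suc (Suc (k + b))) 0\<^esub> \<and>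
        P k b (dT (Suc k) b h) = R (Suc (k + b)) f \<otimes>\<^bsub>C 0 (Suc (k + b))\<^esub> dT 0 (k + b) g))"
  using assms
proof (induction b arbitrary: k A B)
  case 0
  show ?case
  proof (intro exI[of _ A] conjI ballI impI)
    fix h assume h: "h \<in> A" "dT (Suc (Suc k)) 0 (dS (Suc k) 0 h) = \<one>\<^bsub>C (Suc (Suc k)) (Suc 0)\<^esub>"
    have hc: "h \<in> carrier (C (Suc k) 0)"
      using open_carrier[OF 0(1)] h(1) by simp
    interpret comm_group "C 0 (Suc k)" by (rule comm_group_C)
    show "\<exists>f\<in>A. \<exists>g\<in>B. dS (Suc (k + 0)) 0 f = \<one>\<^bsub>C (Suc (Suc (k + 0))) 0\<^esub> \<and>
        P k 0 (dT (Suc k) 0 h) = R (Suc (k + 0)) f \<otimes>\<^bsub>C 0 (Suc (k + 0))\<^esub> dT 0 (k + 0) g"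
      \<comment> \<open>At the end of the zigzag \<open>h\<close> itself is the required
        \<open>f\<close>, with trivial \<open>g\<close>. It is a \<open>dS\<close>-cocycle because
        \<open>dT_inj\<close> applies to \<open>dS (Suc k) 0 h\<close>.\<close>
      using h hc 0(4) by (intro bexI[of _ h] bexI[of _ "\<one>\<^bsub>C 0 k\<^esub>"]) (auto simp: P_dT_0 dT_inj)
  qed (use 0 in auto)
next
  case (Suc b)
  \<comment> \<open>Quotients are needed because the sign in \<open>dT_P\<close> alternates: for
    even \<open>k\<close> the solution involves the inverse of \<open>f\<close> and
    \<open>P k b h\<close> divided by \<open>g\<close>, for odd \<open>k\<close> it involves
    \<open>f\<close> and the reverse quotient.\<close>
  obtain A' where A': "openin (Top (Suc (k + Suc b)) 0) A'" "\<one>\<^bsub>C (Suc (k + Suc b)) 0\<^esub> \<in> A'"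
    "\<And>p q. p \<in> A' \<Longrightarrow> q \<in> A' \<Longrightarrow> p \<otimes>\<^bsub>C (Suc (k + Suc b)) 0\<^esub> inv\<^bsub>C (Suc (k + Suc b)) 0\<^esub> q \<in> A"
    using top_ab_group_diff_nbhd[OF tg Suc.prems(1,2)] by blast
  obtain B' where B': "openin (Top 0 (k + Suc b)) B'" "\<one>\<^bsub>C 0 (k + Suc b)\<^esub> \<in> B'"
    "\<And>p q. p \<in> B' \<Longrightarrow> q \<in> B' \<Longrightarrow> p \<otimes>\<^bsub>C 0 (k + Suc b)\<^esub> inv\<^bsub>C 0 (k + Suc b)\<^esub> q \<in> B"
    using top_ab_group_diff_nbhd[OF tg Suc.prems(3,4)] by blast
  obtain W where W: "openin (Top (Suc (Suc k)) b) W" "\<one>\<^bsub>C (Suc (Suc k)) b\<^esub> \<in> W"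
    and Wsol: "\<And>h. h \<in> W \<Longrightarrow> dT (Suc (Suc (Suc k))) b (dS (Suc (Suc k)) b h) = \<one>\<^bsub>C (Suc (Suc (Suc k))) (Suc b)\<^esub> \<Longrightarrow>
      (\<exists>f\<in>A'. \<exists>g\<in>B'. dS (Suc (Suc k + b)) 0 f = \<one>\<^bsub>C (Suc (Suc (Suc k + b))) 0\<^esub> \<and>
        P (Suc k) b (dT (Suc (Suc k)) b h) = R (Suc (Suc k + b)) f \<otimes>\<^bsub>C 0 (Suc (Suc k + b))\<^esub> dT 0 (Suc k + b) g)"
    using Suc.IH[of "Suc k" A' B'] A' B' by auto
  obtain W' where W': "openin (Top (Suc (Suc k)) (Suc b)) W'" "\<one>\<^bsub>C (Suc (Suc k)) (Suc b)\<^esub> \<in> W'"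
    and lift: "\<And>y. y \<in> W' \<Longrightarrow> dT (Suc (Suc k)) (Suc b) y = \<one>\<^bsub>C (Suc (Suc k)) (Suc (Suc b))\<^esub> \<Longrightarrow>
       \<exists>x\<in>W. dT (Suc (Suc k)) b x = y"
    using dT_preimage_nbhd[OF W] by blast
  \<comment> \<open>Two conditions on \<open>h\<close>: \<open>P k b h\<close> must be small since
    it enters the new \<open>g\<close>, and \<open>dS h\<close> must be small enough to lift into
    \<open>W\<close>.\<close>
  let ?W = "{h \<in> topspace (Top (Suc k) (Suc b)). P k b h \<in> B'} \<inter>
            {h \<in> topspace (Top (Suc k) (Suc b)). dS (Suc k) (Suc b) h \<in> W'}"
  show ?case
  proof (intro exI[of _ ?W] conjI ballI impI)
    show "openin (Top (Suc k) (Suc b)) ?W"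
      using B'(1) W'(1) by (intro openin_Int openin_continuous_map_preimage[OF P_cont]
          openin_continuous_map_preimage[OF dS_cont]) auto
    show "\<one>\<^bsub>C (Suc k) (Suc b)\<^esub> \<in> ?W"
      using B'(2) W'(2) by simp
    fix h assume "h \<in> ?W"
      and "dT (Suc (Suc k)) (Suc b) (dS (Suc k) (Suc b) h) = \<one>\<^bsub>C (Suc (Suc k)) (Suc (Suc b))\<^esub>"
    then have h: "h \<in> carrier (C (Suc k) (Suc b))" "P k b h \<in> B'" "dS (Suc k) (Suc b) h \<in> W'"
      "dT (Suc (Suc k)) (Suc b) (dS (Suc k) (Suc b) h) = \<one>\<^bsub>C (Suc (Suc k)) (Suc (Suc b))\<^esub>"
      by auto
    obtain h' where h': "h' \<in> W" "dT (Suc (Suc k)) b h' = dS (Suc k) (Suc b) h"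
      using lift[OF h(3,4)] by blast
    have h'c: "h' \<in> carrier (C (Suc (Suc k)) b)"
      using open_carrier[OF W(1)] h'(1) by blast
    \<comment> \<open>The induction hypothesis applies to \<open>h'\<close>, since
      \<open>dT (dS h') = dS (dT h') = dS (dS h)\<close> is trivial.\<close>
    have "dT (Suc (Suc (Suc k))) b (dS (Suc (Suc k)) b h') = \<one>\<^bsub>C (Suc (Suc (Suc k))) (Suc b)\<^esub>"
      using h'c h(1) by (simp add: dT_dS h'(2) dS_dS)
    from Wsol[OF h'(1) this] obtain f g where fg: "f \<in> A'" "g \<in> B'"
      "dS (Suc (Suc (k + b))) 0 f = \<one>\<^bsub>C (Suc (Suc (Suc (k + b)))) 0\<^esub>"
      "P (Suc k) b (dS (Suc k) (Suc b) h) =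
        R (Suc (Suc (k + b))) f \<otimes>\<^bsub>C 0 (Suc (Suc (k + b)))\<^esub> dT 0 (Suc (k + b)) g"
      by (auto simp: h'(2))
    have fc: "f \<in> carrier (C (Suc (Suc (k + b))) 0)" and gc: "g \<in> carrier (C 0 (Suc (k + b)))"
      using open_carrier[OF A'(1)] open_carrier[OF B'(1)] fg(1,2) by auto
    interpret G: comm_group "C 0 (Suc (Suc (k + b)))" by (rule comm_group_C)
    interpret F: comm_group "C (Suc (Suc (k + b))) 0" by (rule comm_group_C)
    interpret H: comm_group "C (Suc (Suc (Suc (k + b)))) 0" by (rule comm_group_C)
    let ?p = "P k b h" and ?q = "P k (Suc b) (dT (Suc k) (Suc b) h)"
    have pc: "?p \<in> carrier (C 0 (Suc (k + b)))" and qc: "?q \<in> carrier (C 0 (Suc (Suc (k + b))))"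
      using h(1) maps_closed(4)[of "dT (Suc k) (Suc b) h" k "Suc b"] by auto
    \<comment> \<open>This is \<open>dT_P\<close> for \<open>h\<close>, with the term in
      \<open>dS h = dT h'\<close> replaced by what the induction hypothesis gives for
      \<open>h'\<close>. It remains to solve for \<open>?q\<close>.\<close>
    have eq: "dT 0 (Suc (k + b)) ?p =
        (R (Suc (Suc (k + b))) f \<otimes>\<^bsub>C 0 (Suc (Suc (k + b)))\<^esub> dT 0 (Suc (k + b)) g) \<otimes>\<^bsub>C 0 (Suc (Suc (k + b)))\<^esub>
        (if even k then ?q else inv\<^bsub>C 0 (Suc (Suc (k + b)))\<^esub> ?q)"
      using dT_P[OF h(1)] by (simp add: fg(4))
    show "\<exists>f\<in>A. \<exists>g\<in>B. dS (Suc (k + Suc b)) 0 f = \<one>\<^bsub>C (Suc (Suc (k + Suc b))) 0\<^esub> \<and>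
        ?q = R (Suc (k + Suc b)) f \<otimes>\<^bsub>C 0 (Suc (k + Suc b))\<^esub> dT 0 (k + Suc b) g"
    proof (cases "even k")
      case True
      have "?q = R (Suc (k + Suc b)) (inv\<^bsub>C (Suc (Suc (k + b))) 0\<^esub> f) \<otimes>\<^bsub>C 0 (Suc (k + Suc b))\<^esub>
          dT 0 (k + Suc b) (?p \<otimes>\<^bsub>C 0 (Suc (k + b))\<^esub> inv\<^bsub>C 0 (Suc (k + b))\<^esub> g)"
        using True eq fc gc pc qc
        by (simp add: maps_mult maps_inv G.solve_right_factor)
      moreover have "?p \<otimes>\<^bsub>C 0 (Suc (k + b))\<^esub> inv\<^bsub>C 0 (Suc (k + b))\<^esub> g \<in> B"
        using B'(3)[OF h(2) fg(2)] by simp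
      moreover have "inv\<^bsub>C (Suc (Suc (k + b))) 0\<^esub> f \<in> A"
        using A'(3)[OF A'(2) fg(1)] fc by simp
      moreover have "dS (Suc (k + Suc b)) 0 (inv\<^bsub>C (Suc (Suc (k + b))) 0\<^esub> f) = \<one>\<^bsub>C (Suc (Suc (k + Suc b))) 0\<^esub>"
        using fc fg(3) by (simp add: maps_inv)
      ultimately show ?thesis by blast
    next
      case False
      have "?q = R (Suc (k + Suc b)) f \<otimes>\<^bsub>C 0 (Suc (k + Suc b))\<^esub>
          dT 0 (k + Suc b) (g \<otimes>\<^bsub>C 0 (Suc (k + b))\<^esub> inv\<^bsub>C 0 (Suc (k + b))\<^esub> ?p)"
        using False eq fc gc pc qc
        by (simp add: maps_mult maps_inv G.solve_inv_right_factor)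
      moreover have "g \<otimes>\<^bsub>C 0 (Suc (k + b))\<^esub> inv\<^bsub>C 0 (Suc (k + b))\<^esub> ?p \<in> B"
        using B'(3)[OF fg(2) h(2)] by simp
      moreover have "f \<in> A"
        using A'(3)[OF fg(1) A'(2)] fc by simp
      ultimately show ?thesis using fg(3) by auto
    qed
  qed
qed

text \<open>By translation it suffices to solve near the identity. A cocycle \<open>w\<close> with
  small \<open>dS w\<close> gives a small \<open>h\<close> with \<open>dT h = dS w\<close>, and the
  zigzag from \<open>k = 0\<close> expresses \<open>P 0 n (dS w)\<close>, which is \<open>w\<close>
  itself.\<close>

theorem refinement_open_map:
  "open_map
     (prod_topology
        (subtopology (Top (Suc n) 0) {x \<in> carrier (C (Suc n) 0). dS (Suc n) 0 x = \<one>\<^bsub>C (Suc (Suc n)) 0\<^esub>})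
        (Top 0 n))
     (subtopology (Top 0 (Suc n)) {x \<in> carrier (C 0 (Suc n)). dT 0 (Suc n) x = \<one>\<^bsub>C 0 (Suc (Suc n))\<^esub>})
     (\<lambda>(f, g). R (Suc n) f \<otimes>\<^bsub>C 0 (Suc n)\<^esub> dT 0 n g)"
  (is "open_map (prod_topology (subtopology _ ?ZS) _) (subtopology _ ?ZT) ?\<Phi>")
  unfolding open_map_def
proof (intro allI impI)
  fix Q assume Q: "openin (prod_topology (subtopology (Top (Suc n) 0) ?ZS) (Top 0 n)) Q"
  interpret G: comm_group "C 0 (Suc n)" by (rule comm_group_C)
  interpret G2: comm_group "C 0 (Suc (Suc n))" by (rule comm_group_C)
  interpret F: comm_group "C (Suc n) 0" by (rule comm_group_C)
  interpret F2: comm_group "C (Suc (Suc n)) 0" by (rule comm_group_C)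
  interpret H: comm_group "C 0 n" by (rule comm_group_C)
  have Q_carrier: "f \<in> ?ZS" "g \<in> carrier (C 0 n)" if "(f, g) \<in> Q" for f g
    using openin_subset[OF Q] that by auto
  have in_ZT: "?\<Phi> (f, g) \<in> ?ZT" if "f \<in> ?ZS" "g \<in> carrier (C 0 n)" for f g
    using that by (simp add: maps_mult dT_R dT_dT)
  show "openin (subtopology (Top 0 (Suc n)) ?ZT) (?\<Phi> ` Q)"
  proof (subst openin_subopen, intro ballI)
    fix z0 assume "z0 \<in> ?\<Phi> ` Q"
    then obtain f0 g0 where fg0: "(f0, g0) \<in> Q" "z0 = ?\<Phi> (f0, g0)" by auto
    have c0: "f0 \<in> ?ZS" "g0 \<in> carrier (C 0 n)" "z0 \<in> ?ZT"
      using Q_carrier[OF fg0(1)] in_ZT fg0(2) by auto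
    obtain A0' B0 where "openin (subtopology (Top (Suc n) 0) ?ZS) A0'" "openin (Top 0 n) B0"
      "f0 \<in> A0'" "g0 \<in> B0" "A0' \<times> B0 \<subseteq> Q"
      using Q fg0(1) unfolding openin_prod_topology_alt by meson
    then obtain A0 where A0: "openin (Top (Suc n) 0) A0" "openin (Top 0 n) B0"
      "f0 \<in> A0" "g0 \<in> B0" "(A0 \<inter> ?ZS) \<times> B0 \<subseteq> Q"
      unfolding openin_subtopology by auto
    \<comment> \<open>The box around \<open>(f0, g0)\<close> moved to the identity.
      \<open>A0\<close> is open among all cochains; the cocycle condition is restored later, as the
      zigzag delivers a cocycle \<open>f\<close>.\<close>
    let ?A = "{x \<in> topspace (Top (Suc n) 0). f0 \<otimes>\<^bsub>C (Suc n) 0\<^esub> x \<in> A0}"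
    let ?B = "{x \<in> topspace (Top 0 n). g0 \<otimes>\<^bsub>C 0 n\<^esub> x \<in> B0}"
    have "openin (Top (Suc n) 0) ?A" "openin (Top 0 n) ?B"
      using c0 A0 by (auto intro!: openin_continuous_map_preimage[OF top_ab_group_translate[OF tg]] simp del: topspace_Top)
    moreover have "\<one>\<^bsub>C (Suc n) 0\<^esub> \<in> ?A" "\<one>\<^bsub>C 0 n\<^esub> \<in> ?B"
      using c0 A0 by auto
    ultimately obtain W where W: "openin (Top (Suc 0) n) W" "\<one>\<^bsub>C (Suc 0) n\<^esub> \<in> W"
      and Wsol: "\<And>h. h \<in> W \<Longrightarrow> dT (Suc (Suc 0)) n (dS (Suc 0) n h) = \<one>\<^bsub>C (Suc (Suc 0)) (Suc n)\<^esub> \<Longrightarrow>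
      (\<exists>f\<in>?A. \<exists>g\<in>?B. dS (Suc n) 0 f = \<one>\<^bsub>C (Suc (Suc n)) 0\<^esub> \<and>
        P 0 n (dT (Suc 0) n h) = R (Suc n) f \<otimes>\<^bsub>C 0 (Suc n)\<^esub> dT 0 n g)"
      using small_zigzag[of 0 n ?A ?B] by auto
    obtain W' where W': "openin (Top (Suc 0) (Suc n)) W'" "\<one>\<^bsub>C (Suc 0) (Suc n)\<^esub> \<in> W'"
      and lift: "\<And>y. y \<in> W' \<Longrightarrow> dT (Suc 0) (Suc n) y = \<one>\<^bsub>C (Suc 0) (Suc (Suc n))\<^esub> \<Longrightarrow>
       \<exists>x\<in>W. dT (Suc 0) n x = y"
      using dT_preimage_nbhd[OF W] by blast
    \<comment> \<open>Smallness is imposed only on \<open>dS\<close> of the quotient of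
      \<open>z\<close> by \<open>z0\<close>, since that is all the lifting requires.\<close>
    let ?N = "{z \<in> topspace (Top 0 (Suc n)).
        inv\<^bsub>C 0 (Suc n)\<^esub> z0 \<otimes>\<^bsub>C 0 (Suc n)\<^esub> z \<in> {z \<in> topspace (Top 0 (Suc n)). dS 0 (Suc n) z \<in> W'}}"
    have "openin (Top 0 (Suc n)) ?N"
      using c0(3) W'(1)
      by (intro openin_continuous_map_preimage[OF top_ab_group_translate[OF tg]]
          openin_continuous_map_preimage[OF dS_cont]) auto
    moreover have "z0 \<in> ?N"
      using c0(3) W'(2) by simp
    moreover have "?N \<inter> ?ZT \<subseteq> ?\<Phi> ` Q"
    proof
      fix z assume z: "z \<in> ?N \<inter> ?ZT"
      let ?w = "inv\<^bsub>C 0 (Suc n)\<^esub> z0 \<otimes>\<^bsub>C 0 (Suc n)\<^esub> z"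
      have w: "?w \<in> carrier (C 0 (Suc n))" "dS 0 (Suc n) ?w \<in> W'" "dT 0 (Suc n) ?w = \<one>\<^bsub>C 0 (Suc (Suc n))\<^esub>"
        using z c0(3) by (auto simp: maps_mult maps_inv)
      have "dT (Suc 0) (Suc n) (dS 0 (Suc n) ?w) = \<one>\<^bsub>C (Suc 0) (Suc (Suc n))\<^esub>"
        using w dT_dS by simp
      with w lift obtain h where h: "h \<in> W" "dT (Suc 0) n h = dS 0 (Suc n) ?w" by blast
      have hc: "h \<in> carrier (C (Suc 0) n)"
        using open_carrier[OF W(1)] h(1) by blast
      have "dT (Suc (Suc 0)) n (dS (Suc 0) n h) = \<one>\<^bsub>C (Suc (Suc 0)) (Suc n)\<^esub>"
        using dT_dS[OF hc] dS_dS[OF w(1)] h(2) by simp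
      from Wsol[OF h(1) this] obtain f g where fg: "f \<in> ?A" "g \<in> ?B" "dS (Suc n) 0 f = \<one>\<^bsub>C (Suc (Suc n)) 0\<^esub>"
        "?w = R (Suc n) f \<otimes>\<^bsub>C 0 (Suc n)\<^esub> dT 0 n g"
        using P_0_dS[OF w(1)] h(2) by auto
      have fgc: "f \<in> carrier (C (Suc n) 0)" "g \<in> carrier (C 0 n)" using fg by auto
      have "z = z0 \<otimes>\<^bsub>C 0 (Suc n)\<^esub> ?w"
        using z c0(3) by (simp add: G.m_assoc[symmetric])
      also have "\<dots> = ?\<Phi> (f0 \<otimes>\<^bsub>C (Suc n) 0\<^esub> f, g0 \<otimes>\<^bsub>C 0 n\<^esub> g)"
        using c0 fgc by (subst fg(4)) (simp add: fg0(2) maps_mult G.m_ac)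
      finally have "z = ?\<Phi> (f0 \<otimes>\<^bsub>C (Suc n) 0\<^esub> f, g0 \<otimes>\<^bsub>C 0 n\<^esub> g)" .
      moreover have "(f0 \<otimes>\<^bsub>C (Suc n) 0\<^esub> f, g0 \<otimes>\<^bsub>C 0 n\<^esub> g) \<in> Q"
        \<comment> \<open>The product of \<open>f0\<close> and \<open>f\<close> lies in
          \<open>A0\<close> by the choice of \<open>?A\<close>, and it is a cocycle because both
          factors are.\<close>
        using fg fgc c0 A0(5) by (auto simp: maps_mult)
      ultimately show "z \<in> ?\<Phi> ` Q" by (rule image_eqI)
    qed
    ultimately show "\<exists>N. openin (subtopology (Top 0 (Suc n)) ?ZT) N \<and> z0 \<in> N \<and> N \<subseteq> ?\<Phi> ` Q"
      using c0(3) unfolding openin_subtopology by blast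
  qed
qed

end

section \<open>Groups of sections\<close>

lemma local_homeoI:
  assumes "continuous_map X Y f" "open_map X Y f"
    and "\<And>x. x \<in> topspace X \<Longrightarrow> \<exists>W. openin X W \<and> x \<in> W \<and> inj_on f W"
  shows "local_homeo X Y f"
  unfolding local_homeo_def
proof (intro conjI ballI)
  fix x assume "x \<in> topspace X"
  then obtain W where W: "openin X W" "x \<in> W" "inj_on f W" using assms(3) by blast
  have sub: "W \<subseteq> topspace X" using W(1) by (rule openin_subset)
  have fW: "openin Y (f ` W)" using assms(2) W(1) by (simp add: open_map_def)
  have "homeomorphic_map (subtopology X W) (subtopology Y (f ` W)) f"
  proof (rule bijective_open_imp_homeomorphic_map)
    show "continuous_map (subtopology X W) (subtopology Y (f ` W)) f"
      using assms(1) by (simp add: continuous_map_from_subtopology continuous_map_in_subtopology)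
    show "open_map (subtopology X W) (subtopology Y (f ` W)) f"
      unfolding open_map_def openin_open_subtopology[OF W(1)] openin_open_subtopology[OF fW]
      using assms(2) by (auto simp: open_map_def)
    show "f ` topspace (subtopology X W) = topspace (subtopology Y (f ` W))"
      using sub openin_subset[OF fW] by (auto simp: topspace_subtopology)
    show "inj_on f (topspace (subtopology X W))"
      using W(3) sub by (simp add: topspace_subtopology Int_absorb1)
  qed
  then show "\<exists>W. openin X W \<and> x \<in> W \<and> openin Y (f ` W) \<and>
      homeomorphic_map (subtopology X W) (subtopology Y (f ` W)) f"
    using W fW by blast
qed (rule assms(1))

text \<open>\<open>sadd\<close> is meaningful only for points over the same base point; fixing that
  point yields an honest group to which the \<open>cdiff\<close> identities apply.\<close>

definition stalk :: "('a, 'e) ab_sheaf \<Rightarrow> 'a \<Rightarrow> 'e monoid" where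
  "stalk S x = \<lparr>carrier = {e \<in> topspace (etale S). proj S e = x}, mult = sadd S, one = szero S x\<rparr>"

lemma stalk_simps [simp]:
  "carrier (stalk S x) = {e \<in> topspace (etale S). proj S e = x}"
  "mult (stalk S x) = sadd S" "one (stalk S x) = szero S x"
  by (simp_all add: stalk_def)

lemma comm_group_stalk:
  assumes "is_ab_sheaf S" "x \<in> topspace (base S)"
  shows "comm_group (stalk S x)"
proof (rule comm_groupI)
  fix e assume "e \<in> carrier (stalk S x)"
  then show "\<exists>y\<in>carrier (stalk S x). y \<otimes>\<^bsub>stalk S x\<^esub> e = \<one>\<^bsub>stalk S x\<^esub>"
    using assms by (intro bexI[of _ "sneg S e"]) (auto simp: is_ab_sheaf_def)
qed (use assms in \<open>auto simp: is_ab_sheaf_def\<close>)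

lemma inv_stalk:
  assumes "is_ab_sheaf S" "x \<in> topspace (base S)" "e \<in> carrier (stalk S x)"
  shows "inv\<^bsub>stalk S x\<^esub> e = sneg S e"
proof -
  interpret comm_group "stalk S x" using assms(1,2) by (rule comm_group_stalk)
  show ?thesis
    by (rule inv_equality) (use assms in \<open>auto simp: is_ab_sheaf_def\<close>)
qed

lemma sect_eqI:
  assumes "f \<in> sect S X \<pi>" "g \<in> sect S X \<pi>" "\<And>u. u \<in> topspace X \<Longrightarrow> f u = g u"
  shows "f = g"
  using assms by (auto simp: sect_def intro: extensionalityI)

lemma sect_stalk:
  "f \<in> sect S X \<pi> \<Longrightarrow> u \<in> topspace X \<Longrightarrow> f u \<in> carrier (stalk S (\<pi> u))"
  by (auto simp: sect_def continuous_map_def)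

definition sections :: "('a, 'e) ab_sheaf \<Rightarrow> 'u topology \<Rightarrow> ('u \<Rightarrow> 'a) \<Rightarrow> ('u \<Rightarrow> 'e) monoid" where
  "sections S X \<pi> = \<lparr>carrier = sect S X \<pi>, mult = sec_add S X, one = sec_zero S X \<pi>\<rparr>"

lemma sections_simps [simp]:
  "carrier (sections S X \<pi>) = sect S X \<pi>"
  "mult (sections S X \<pi>) = sec_add S X" "one (sections S X \<pi>) = sec_zero S X \<pi>"
  by (simp_all add: sections_def)

locale topologized_sheaf =
  fixes S :: "('a, 'e) ab_sheaf"
    and T :: "'u topology \<Rightarrow> ('u \<Rightarrow> 'a) \<Rightarrow> ('u \<Rightarrow> 'e) topology"
  assumes sheaf: "is_ab_sheaf S"
    and topologized: "topologized S T"
begin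

lemma topspace_T: "Hausdorff_space X \<Longrightarrow> local_homeo X (base S) \<pi> \<Longrightarrow> topspace (T X \<pi>) = sect S X \<pi>"
  using topologized by (simp add: topologized_def)

lemma sec_zero_in_sect:
  assumes "local_homeo X (base S) \<pi>"
  shows "sec_zero S X \<pi> \<in> sect S X \<pi>"
proof -
  have pi: "continuous_map X (base S) \<pi>"
    using assms by (simp add: local_homeo_def)
  have "continuous_map X (etale S) (szero S \<circ> \<pi>)"
    by (rule continuous_map_compose[OF pi]) (use sheaf in \<open>simp add: is_ab_sheaf_def\<close>)
  then have "continuous_map X (etale S) (sec_zero S X \<pi>)"
    by (rule continuous_map_eq) (simp add: sec_zero_def)
  moreover have "\<pi> u \<in> topspace (base S)" if "u \<in> topspace X" for u
    using pi that by (auto simp: continuous_map_def)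
  ultimately show ?thesis
    using sheaf by (auto simp: sect_def sec_zero_def extensional_def is_ab_sheaf_def)
qed

text \<open>Closure is read off from the continuity part of \<open>topologized\<close>, because a
  continuous map sends carrier to carrier and the carriers are the sets of sections.\<close>

lemma sec_ops_closed:
  fixes X :: "'u topology"
  assumes "Hausdorff_space X" "local_homeo X (base S) \<pi>" "f \<in> sect S X \<pi>"
  shows "g \<in> sect S X \<pi> \<Longrightarrow> sec_add S X f g \<in> sect S X \<pi>" "sec_neg S X f \<in> sect S X \<pi>"
proof -
  have "continuous_map (prod_topology (T X \<pi>) (T X \<pi>)) (T X \<pi>) (\<lambda>(s, s'). sec_add S X s s')"
    "continuous_map (T X \<pi>) (T X \<pi>) (sec_neg S X)"
    using topologized assms by (auto simp: topologized_def)
  then have "(\<lambda>(s, s'). sec_add S X s s') \<in> sect S X \<pi> \<times> sect S X \<pi> \<rightarrow> sect S X \<pi>"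
    "sec_neg S X \<in> sect S X \<pi> \<rightarrow> sect S X \<pi>"
    by (auto simp only: continuous_map_def topspace_T[OF assms(1,2)] topspace_prod_topology)
  then show "g \<in> sect S X \<pi> \<Longrightarrow> sec_add S X f g \<in> sect S X \<pi>" "sec_neg S X f \<in> sect S X \<pi>"
    using assms(3) by (auto dest: funcset_mem[of _ _ _ "(f, g)"])
qed

text \<open>The group laws are checked pointwise in the stalks; \<open>sect_eqI\<close> reduces
  equality of sections to their values on the carrier.\<close>

lemma
  fixes X :: "'u topology"
  assumes "Hausdorff_space X" "local_homeo X (base S) \<pi>"
  shows comm_group_sections: "comm_group (sections S X \<pi>)"
    and inv_sections: "f \<in> sect S X \<pi> \<Longrightarrow> inv\<^bsub>sections S X \<pi>\<^esub> f = sec_neg S X f"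
    and top_ab_group_sections: "top_ab_group (sections S X \<pi>) (T X \<pi>)"
proof -
  note closed = sec_zero_in_sect[OF assms(2)] sec_ops_closed[OF assms]
  have base: "\<pi> u \<in> topspace (base S)" if "u \<in> topspace X" for u
    using assms(2) that by (auto simp: local_homeo_def continuous_map_def)
  have stalk: "comm_group (stalk S (\<pi> u))" if "u \<in> topspace X" for u
    using comm_group_stalk[OF sheaf base[OF that]] .
  have neg: "sec_add S X (sec_neg S X f) f = sec_zero S X \<pi>" if "f \<in> sect S X \<pi>" for f
  proof (rule sect_eqI[of _ S X \<pi>])
    fix u assume u: "u \<in> topspace X"
    interpret comm_group "stalk S (\<pi> u)" by (rule stalk[OF u])
    show "sec_add S X (sec_neg S X f) f u = sec_zero S X \<pi> u"
      using l_inv[OF sect_stalk[OF that u]] inv_stalk[OF sheaf base[OF u] sect_stalk[OF that u]] u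
      by (simp add: sec_add_def sec_neg_def sec_zero_def)
  qed (use closed that in auto)
  show G: "comm_group (sections S X \<pi>)"
  proof (rule comm_groupI, unfold sections_simps)
    fix f g h assume fgh: "f \<in> sect S X \<pi>" "g \<in> sect S X \<pi>" "h \<in> sect S X \<pi>"
    show "sec_add S X (sec_add S X f g) h = sec_add S X f (sec_add S X g h)"
    proof (rule sect_eqI[of _ S X \<pi>])
      fix u assume u: "u \<in> topspace X"
      interpret comm_group "stalk S (\<pi> u)" by (rule stalk[OF u])
      show "sec_add S X (sec_add S X f g) h u = sec_add S X f (sec_add S X g h) u"
        using m_assoc[OF sect_stalk[OF fgh(1) u] sect_stalk[OF fgh(2) u] sect_stalk[OF fgh(3) u]] u
        by (simp add: sec_add_def)
    qed (use closed fgh in auto)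
  next
    fix f g assume fg: "f \<in> sect S X \<pi>" "g \<in> sect S X \<pi>"
    show "sec_add S X f g = sec_add S X g f"
    proof (rule sect_eqI[of _ S X \<pi>])
      fix u assume u: "u \<in> topspace X"
      interpret comm_group "stalk S (\<pi> u)" by (rule stalk[OF u])
      show "sec_add S X f g u = sec_add S X g f u"
        using m_comm[OF sect_stalk[OF fg(1) u] sect_stalk[OF fg(2) u]] u
        by (simp add: sec_add_def)
    qed (use closed fg in auto)
  next
    fix f assume f: "f \<in> sect S X \<pi>"
    show "sec_add S X (sec_zero S X \<pi>) f = f"
    proof (rule sect_eqI[of _ S X \<pi>])
      fix u assume u: "u \<in> topspace X"
      interpret comm_group "stalk S (\<pi> u)" by (rule stalk[OF u])
      show "sec_add S X (sec_zero S X \<pi>) f u = f u"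
        using l_one[OF sect_stalk[OF f u]] u
        by (simp add: sec_add_def sec_zero_def)
    qed (use closed f in auto)
    show "\<exists>g\<in>sect S X \<pi>. sec_add S X g f = sec_zero S X \<pi>"
      using neg[OF f] closed(3)[OF f] by blast
  qed (use closed in auto)
  interpret comm_group "sections S X \<pi>" by (rule G)
  show inv: "inv\<^bsub>sections S X \<pi>\<^esub> f = sec_neg S X f" if "f \<in> sect S X \<pi>" for f
    by (rule inv_equality) (use neg that closed in auto)
  have "continuous_map (T X \<pi>) (T X \<pi>) (sec_neg S X)"
    using topologized assms by (simp add: topologized_def)
  then have "continuous_map (T X \<pi>) (T X \<pi>) (m_inv (sections S X \<pi>))"
    by (rule continuous_map_eq) (simp add: topspace_T assms inv)
  then show "top_ab_group (sections S X \<pi>) (T X \<pi>)"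
    using topologized assms G by (simp add: top_ab_group_def topologized_def)
qed

lemma continuous_pullback:
  assumes "Hausdorff_space X" "Hausdorff_space Y" "local_homeo Y (base S) \<pi>"
    and "local_homeo X Y \<phi>" "\<pi> \<circ> \<phi> = \<pi>'"
  shows "continuous_map (T Y \<pi>) (T X \<pi>') (\<lambda>f. restrict (f \<circ> \<phi>) (topspace X))"
  using topologized assms unfolding topologized_def by blast

text \<open>Each summand is a pullback along \<open>\<phi> m\<close>, up to sign, and the sum is
  built by continuous addition along the list. With face maps for \<open>\<phi> m\<close> this
  yields both Cech differentials.\<close>

lemma continuous_alternating_sum:
  assumes "Hausdorff_space X" "Hausdorff_space Y"
    and "local_homeo X (base S) \<pi>'" "local_homeo Y (base S) \<pi>"
    and "\<And>m. m \<in> set ms \<Longrightarrow> local_homeo X Y (\<phi> m) \<and> \<pi> \<circ> \<phi> m = \<pi>'"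
  shows "continuous_map (T Y \<pi>) (T X \<pi>')
    (\<lambda>f u. if u \<in> topspace X then fsum S (\<pi>' u) (map (\<lambda>m. signed S m (f (\<phi> m u))) ms) else undefined)"
  using assms(5)
proof (induction ms)
  case Nil
  have "continuous_map (T Y \<pi>) (T X \<pi>') (\<lambda>_. sec_zero S X \<pi>')"
    using sec_zero_in_sect[OF assms(3)] assms(1,3) by (simp add: topspace_T)
  moreover have "(\<lambda>_. sec_zero S X \<pi>') = (\<lambda>f u. if u \<in> topspace X
      then fsum S (\<pi>' u) (map (\<lambda>m. signed S m (f (\<phi> m u))) []) else undefined)"
    by (auto simp: fsum_def sec_zero_def fun_eq_iff)
  ultimately show ?case by (simp only:)
next
  case (Cons m ms)
  let ?p = "\<lambda>f. restrict (f \<circ> \<phi> m) (topspace X)"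
  let ?r = "\<lambda>f u. if u \<in> topspace X then fsum S (\<pi>' u) (map (\<lambda>m. signed S m (f (\<phi> m u))) ms) else undefined"
  have p: "continuous_map (T Y \<pi>) (T X \<pi>') ?p"
    by (rule continuous_pullback[OF assms(1,2,4)]) (use Cons.prems[OF list.set_intros(1)] in blast)+
  have neg: "continuous_map (T X \<pi>') (T X \<pi>') (sec_neg S X)"
    and add: "continuous_map (prod_topology (T X \<pi>') (T X \<pi>')) (T X \<pi>') (\<lambda>(s, s'). sec_add S X s s')"
    using topologized assms by (auto simp: topologized_def)
  let ?q = "\<lambda>f. if even m then ?p f else sec_neg S X (?p f)"
  have q: "continuous_map (T Y \<pi>) (T X \<pi>') ?q"
    using p continuous_map_compose[OF p neg] by (cases "even m") (auto simp: o_def)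
  have "continuous_map (T Y \<pi>) (prod_topology (T X \<pi>') (T X \<pi>')) (\<lambda>f. (?q f, ?r f))"
    using q Cons by (simp add: continuous_map_paired)
  from continuous_map_compose[OF this add]
  have "continuous_map (T Y \<pi>) (T X \<pi>') (\<lambda>f. sec_add S X (?q f) (?r f))"
    by (simp add: o_def)
  moreover have "(\<lambda>f. sec_add S X (?q f) (?r f)) = (\<lambda>f u. if u \<in> topspace X
      then fsum S (\<pi>' u) (map (\<lambda>m. signed S m (f (\<phi> m u))) (m # ms)) else undefined)"
    by (auto simp: sec_add_def sec_neg_def fsum_def signed_def fun_eq_iff)
  ultimately show ?case by simp
qed

end

section \<open>The Cech double complex of two covers\<close>

lemma set_del_at: "set (del_at m s) \<subseteq> set s"
  by (auto simp: del_at_def dest: in_set_takeD in_set_dropD)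

lemma length_del_at: "m < length s \<Longrightarrow> Suc (length (del_at m s)) = length s"
  by (auto simp: del_at_def)

lemma openin_isect:
  assumes "open_cover M K W" "set s \<subseteq> K"
  shows "openin M (isect M W s)"
proof -
  \<comment> \<open>Adjoining the whole space keeps the family nonempty for the empty tuple.\<close>
  have "openin M (\<Inter> (insert (topspace M) (W ` set s)))"
    by (rule openin_Inter) (use assms in \<open>auto simp: open_cover_def\<close>)
  then show ?thesis by (simp add: isect_def)
qed

locale cech_covers = topologized_sheaf S T
  for S :: "('a, 'e) ab_sheaf"
    and T :: "(('i list \<times> 'j list) \<times> 'a) topology \<Rightarrow> ((('i list \<times> 'j list) \<times> 'a) \<Rightarrow> 'a)
              \<Rightarrow> ((('i list \<times> 'j list) \<times> 'a) \<Rightarrow> 'e) topology" +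
  fixes I :: "'i set" and U :: "'i \<Rightarrow> 'a set"
    and J :: "'j set" and V :: "'j \<Rightarrow> 'a set"
    and \<tau> :: "'j \<Rightarrow> 'i"
  assumes Hausdorff_base: "Hausdorff_space (base S)"
    and cover_U: "open_cover (base S) I U"
    and cover_V: "open_cover (base S) J V"
    and refines: "\<And>j. j \<in> J \<Longrightarrow> \<tau> j \<in> I \<and> V j \<subseteq> U (\<tau> j)"
begin

section \<open>Topology of the disjoint unions of intersections\<close>

abbreviation X :: "nat \<Rightarrow> nat \<Rightarrow> (('i list \<times> 'j list) \<times> 'a) topology" where
  "X a b \<equiv> cech_space (base S) I U J V a b"

abbreviation sec :: "nat \<Rightarrow> nat \<Rightarrow> ((('i list \<times> 'j list) \<times> 'a) \<Rightarrow> 'e) set" where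
  "sec a b \<equiv> sect S (X a b) snd"

lemma in_topspace_X:
  "((s, t), x) \<in> topspace (X a b) \<longleftrightarrow>
    set s \<subseteq> I \<and> length s = a \<and> set t \<subseteq> J \<and> length t = b \<and> x \<in> topspace (base S) \<and>
    (\<forall>i\<in>set s. x \<in> U i) \<and> (\<forall>j\<in>set t. x \<in> V j)"
  by (auto simp: cech_space_def isect_def topspace_subtopology)

text \<open>The slices range over all index pairs, since a slice over an invalid pair is empty.
  Later openness proofs thus carry no conditions on the indices.\<close>

lemma openin_X_iff:
  "openin (X a b) Q \<longleftrightarrow> Q \<subseteq> topspace (X a b) \<and> (\<forall>st. openin (base S) {x. (st, x) \<in> Q})"
proof -
  let ?K = "{(s, t). set s \<subseteq> I \<and> length s = a \<and> set t \<subseteq> J \<and> length t = b}"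
  have sub: "openin (base S) (isect (base S) U s \<inter> isect (base S) V t)" if "(s, t) \<in> ?K" for s t
    using that openin_isect[OF cover_U] openin_isect[OF cover_V] by (intro openin_Int) auto
  have slice: "openin (subtopology (base S) (isect (base S) U s \<inter> isect (base S) V t)) {x. ((s, t), x) \<in> Q}
      \<longleftrightarrow> openin (base S) {x. ((s, t), x) \<in> Q}"
    if "(s, t) \<in> ?K" "Q \<subseteq> topspace (X a b)" for s t
    using that by (auto simp: openin_open_subtopology[OF sub[OF that(1)]] cech_space_def topspace_subtopology)
  have empty: "openin (base S) {x. ((s, t), x) \<in> Q}" if "(s, t) \<notin> ?K" "Q \<subseteq> topspace (X a b)" for s t
  proof -
    have "((s, t), x) \<notin> Q" for x
      using that(1) subsetD[OF that(2), of "((s, t), x)"] by (auto simp: in_topspace_X)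
    then show ?thesis by simp
  qed
  have "openin (X a b) Q \<longleftrightarrow> Q \<subseteq> topspace (X a b) \<and>
     (\<forall>(s, t)\<in>?K. openin (subtopology (base S) (isect (base S) U s \<inter> isect (base S) V t)) {x. ((s, t), x) \<in> Q})"
    unfolding cech_space_def openin_sum_topology topspace_sum_topology by (auto simp: case_prod_beta)
  also have "\<dots> \<longleftrightarrow> Q \<subseteq> topspace (X a b) \<and> (\<forall>s t. openin (base S) {x. ((s, t), x) \<in> Q})"
  proof (intro conj_cong refl iffI allI ballI)
    fix s t assume Q: "Q \<subseteq> topspace (X a b)"
      and A: "\<forall>(s, t)\<in>?K. openin (subtopology (base S) (isect (base S) U s \<inter> isect (base S) V t)) {x. ((s, t), x) \<in> Q}"
    show "openin (base S) {x. ((s, t), x) \<in> Q}"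
    proof (cases "(s, t) \<in> ?K")
      case True
      then show ?thesis using bspec[OF A True] slice[OF True Q] by (simp only: prod.case)
    next
      case False
      then show ?thesis using Q by (rule empty)
    qed
  next
    fix st assume Q: "Q \<subseteq> topspace (X a b)" and A: "\<forall>s t. openin (base S) {x. ((s, t), x) \<in> Q}" and st: "st \<in> ?K"
    obtain s t where eq: "st = (s, t)" by fastforce
    show "case st of (s, t) \<Rightarrow> openin (subtopology (base S) (isect (base S) U s \<inter> isect (base S) V t)) {x. ((s, t), x) \<in> Q}"
      using slice[OF st[unfolded eq] Q] A by (simp only: eq prod.case)
  qed
  finally show ?thesis by simp
qed

lemma openin_slice: "openin (X a b) Q \<Longrightarrow> openin (base S) {x. (st, x) \<in> Q}"
  using openin_X_iff by blast

lemma openin_box: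
  assumes "openin (base S) A"
  shows "openin (X a b) {u \<in> topspace (X a b). fst u = st \<and> snd u \<in> A}"
  unfolding openin_X_iff
proof (intro conjI allI)
  fix st'
  have "openin (base S) ({x. (st', x) \<in> topspace (X a b)} \<inter> A)"
    by (intro openin_Int assms openin_slice[of a b "topspace (X a b)"]) simp
  moreover have "{x. (st', x) \<in> {u \<in> topspace (X a b). fst u = st \<and> snd u \<in> A}}
    = (if st' = st then {x. (st', x) \<in> topspace (X a b)} \<inter> A else {})"
    by auto
  ultimately show "openin (base S) {x. (st', x) \<in> {u \<in> topspace (X a b). fst u = st \<and> snd u \<in> A}}"
    by (cases "st' = st") (simp_all only: if_True if_False openin_empty simp_thms)
qed auto

lemma Hausdorff_X: "Hausdorff_space (X a b)"
  unfolding Hausdorff_space_def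
proof (intro allI impI)
  fix u v assume uv: "u \<in> topspace (X a b) \<and> v \<in> topspace (X a b) \<and> u \<noteq> v"
  have b: "snd u \<in> topspace (base S)" "snd v \<in> topspace (base S)"
    using uv in_topspace_X by (cases u; cases v; auto)+
  let ?B = "\<lambda>st A. {u \<in> topspace (X a b). fst u = st \<and> snd u \<in> A}"
  \<comment> \<open>Points on the same sheet are separated in the base; points on different sheets
    are separated by the sheets themselves.\<close>
  obtain A B where AB: "openin (base S) A" "openin (base S) B" "snd u \<in> A" "snd v \<in> B"
    "fst u = fst v \<longrightarrow> disjnt A B"
  proof (cases "fst u = fst v")
    case True
    then have "snd u \<noteq> snd v" using uv by (auto simp: prod_eq_iff)
    then show ?thesis using Hausdorff_base b that unfolding Hausdorff_space_def by meson
  next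
    case False
    then show ?thesis using b that[of "topspace (base S)" "topspace (base S)"] by auto
  qed
  show "\<exists>A B. openin (X a b) A \<and> openin (X a b) B \<and> u \<in> A \<and> v \<in> B \<and> disjnt A B"
    by (rule exI[of _ "?B (fst u) A"], rule exI[of _ "?B (fst v) B"])
      (use uv AB openin_box in \<open>auto simp: disjnt_iff\<close>)
qed

text \<open>Such a map carries each sheet by inclusion into another, hence is injective on sheets; a
  slice of an image is a union of slices. Faces, refinement and the Alexander--Whitney maps are all
  pullbacks along maps of this kind.\<close>

lemma local_homeo_reindex:
  assumes "\<And>st x. (st, x) \<in> topspace (X a b) \<Longrightarrow> (\<phi> st, x) \<in> topspace (X a' b')"
  shows "local_homeo (X a b) (X a' b') (apfst \<phi>)"
proof (rule local_homeoI)
  show "continuous_map (X a b) (X a' b') (apfst \<phi>)"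
    unfolding continuous_map_def
  proof (intro conjI allI impI)
    show "apfst \<phi> \<in> topspace (X a b) \<rightarrow> topspace (X a' b')"
      using assms by auto
    fix Q assume Q: "openin (X a' b') Q"
    have "openin (base S) ({x. (st, x) \<in> topspace (X a b)} \<inter> {x. (\<phi> st, x) \<in> Q})" for st
      by (intro openin_Int openin_slice[OF Q] openin_slice[of a b "topspace (X a b)"]) simp
    then show "openin (X a b) {u \<in> topspace (X a b). apfst \<phi> u \<in> Q}"
      by (auto simp: openin_X_iff Collect_conj_eq)
  qed
  show "open_map (X a b) (X a' b') (apfst \<phi>)"
    unfolding open_map_def
  proof (intro allI impI)
    fix Q assume Q: "openin (X a b) Q"
    have "openin (base S) (\<Union>st\<in>\<phi> -` {st'}. {x. (st, x) \<in> Q})" for st'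
      using openin_slice[OF Q] by (intro openin_Union) auto
    moreover have "{x. (st', x) \<in> apfst \<phi> ` Q} = (\<Union>st\<in>\<phi> -` {st'}. {x. (st, x) \<in> Q})" for st'
      by force
    moreover have "apfst \<phi> ` Q \<subseteq> topspace (X a' b')"
    proof
      fix v assume "v \<in> apfst \<phi> ` Q"
      then obtain st x where "(st, x) \<in> Q" "v = (\<phi> st, x)" by force
      then show "v \<in> topspace (X a' b')" using openin_subset[OF Q] assms by blast
    qed
    ultimately show "openin (X a' b') (apfst \<phi> ` Q)"
      unfolding openin_X_iff by simp
  qed
  show "\<exists>W. openin (X a b) W \<and> u \<in> W \<and> inj_on (apfst \<phi>) W" if "u \<in> topspace (X a b)" for u
    by (rule exI[of _ "{v \<in> topspace (X a b). fst v = fst u \<and> snd v \<in> topspace (base S)}"])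
      (use that openin_box[OF openin_topspace] in \<open>cases u, auto simp: inj_on_def in_topspace_X\<close>)
qed

lemma local_homeo_snd: "local_homeo (X a b) (base S) snd"
proof (rule local_homeoI)
  show "continuous_map (X a b) (base S) snd"
    unfolding continuous_map_def
  proof (intro conjI allI impI)
    show "snd \<in> topspace (X a b) \<rightarrow> topspace (base S)"
      by (auto simp: in_topspace_X)
    fix Q assume Q: "openin (base S) Q"
    have "openin (base S) ({x. (st, x) \<in> topspace (X a b)} \<inter> Q)" for st
      by (intro openin_Int Q openin_slice[of a b "topspace (X a b)"]) simp
    then show "openin (X a b) {u \<in> topspace (X a b). snd u \<in> Q}"
      by (auto simp: openin_X_iff Collect_conj_eq)
  qed
  show "open_map (X a b) (base S) snd"
    unfolding open_map_def
  proof (intro allI impI)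
    fix Q assume Q: "openin (X a b) Q"
    have "openin (base S) (\<Union>st. {x. (st, x) \<in> Q})"
      using openin_slice[OF Q] by (intro openin_Union) auto
    moreover have "snd ` Q = (\<Union>st. {x. (st, x) \<in> Q})"
      by force
    ultimately show "openin (base S) (snd ` Q)" by simp
  qed
  show "\<exists>W. openin (X a b) W \<and> u \<in> W \<and> inj_on snd W" if "u \<in> topspace (X a b)" for u
    by (rule exI[of _ "{v \<in> topspace (X a b). fst v = fst u \<and> snd v \<in> topspace (base S)}"])
      (use that openin_box[OF openin_topspace] in \<open>cases u, auto simp: inj_on_def in_topspace_X\<close>)
qed

lemmas topspace_TX = topspace_T[OF Hausdorff_X local_homeo_snd]

lemma continuous_TX_closed:
  assumes "continuous_map (T (X a b) snd) (T (X a' b') snd) F" "f \<in> sec a b"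
  shows "F f \<in> sec a' b'"
proof -
  have "F \<in> sec a b \<rightarrow> sec a' b'"
    using assms(1) by (simp only: continuous_map_def topspace_TX)
  then show ?thesis using assms(2) by (rule funcset_mem)
qed

lemma continuous_reindex:
  assumes "\<And>st x. (st, x) \<in> topspace (X a b) \<Longrightarrow> (\<phi> st, x) \<in> topspace (X a' b')"
  shows "continuous_map (T (X a' b') snd) (T (X a b) snd)
    (\<lambda>f. restrict (f \<circ> apfst \<phi>) (topspace (X a b)))"
proof (rule continuous_pullback[OF Hausdorff_X Hausdorff_X local_homeo_snd])
  show "local_homeo (X a b) (X a' b') (apfst \<phi>)"
    using assms by (rule local_homeo_reindex)
qed (rule snd_comp_apfst)

lemma reindex_hom:
  assumes "\<And>st x. (st, x) \<in> topspace (X a b) \<Longrightarrow> (\<phi> st, x) \<in> topspace (X a' b')"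
  shows "(\<lambda>f. restrict (f \<circ> apfst \<phi>) (topspace (X a b)))
    \<in> hom (sections S (X a' b') snd) (sections S (X a b) snd)"
proof (rule homI)
  fix f g assume f: "f \<in> carrier (sections S (X a' b') snd)"
  have "continuous_map (T (X a' b') snd) (T (X a b) snd) (\<lambda>f. restrict (f \<circ> apfst \<phi>) (topspace (X a b)))"
    by (rule continuous_reindex[of a b \<phi> a' b']) (rule assms)
  from continuous_TX_closed[OF this] f show "restrict (f \<circ> apfst \<phi>) (topspace (X a b)) \<in> carrier (sections S (X a b) snd)"
    unfolding sections_simps .
  show "restrict ((f \<otimes>\<^bsub>sections S (X a' b') snd\<^esub> g) \<circ> apfst \<phi>) (topspace (X a b)) =
     restrict (f \<circ> apfst \<phi>) (topspace (X a b)) \<otimes>\<^bsub>sections S (X a b) snd\<^esub>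
     restrict (g \<circ> apfst \<phi>) (topspace (X a b))"
  proof
    fix u show "restrict ((f \<otimes>\<^bsub>sections S (X a' b') snd\<^esub> g) \<circ> apfst \<phi>) (topspace (X a b)) u =
     (restrict (f \<circ> apfst \<phi>) (topspace (X a b)) \<otimes>\<^bsub>sections S (X a b) snd\<^esub>
     restrict (g \<circ> apfst \<phi>) (topspace (X a b))) u"
      using assms[of "fst u" "snd u"] by (cases u) (simp add: sec_add_def)
  qed
qed

section \<open>The two Cech differentials and their evaluation in stalks\<close>

lemma face_in_X:
  "((s, t), x) \<in> topspace (X a (Suc b)) \<Longrightarrow> set t' \<subseteq> set t \<Longrightarrow> Suc (length t') = length t \<Longrightarrow>
    ((s, t'), x) \<in> topspace (X a b)"
  "((s, t), x) \<in> topspace (X (Suc a) b) \<Longrightarrow> set s' \<subseteq> set s \<Longrightarrow> Suc (length s') = length s \<Longrightarrow>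
    ((s', t), x) \<in> topspace (X a b)"
  by (auto simp: in_topspace_X)

lemma
  shows continuous_dT: "continuous_map (T (X a b) snd) (T (X a (Suc b)) snd) (dT S (X a (Suc b)))"
    and continuous_dS: "continuous_map (T (X a b) snd) (T (X (Suc a) b) snd) (dS S (X (Suc a) b))"
proof -
  \<comment> \<open>\<open>?t m\<close> and \<open>?s m\<close> are the geometric face maps. On the
    target space the tuple has fixed length, so the range \<open>[0..<length t]\<close> in
    \<open>dT_def\<close> becomes \<open>[0..<Suc b]\<close>, and similarly for
    \<open>dS\<close>.\<close>
  let ?t = "\<lambda>m. apfst (\<lambda>(s, t). (s, del_at m t)) :: ('i list \<times> 'j list) \<times> 'a \<Rightarrow> _"
  let ?s = "\<lambda>m. apfst (\<lambda>(s, t). (del_at m s, t)) :: ('i list \<times> 'j list) \<times> 'a \<Rightarrow> _"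
  have "continuous_map (T (X a b) snd) (T (X a (Suc b)) snd)
    (\<lambda>f u. if u \<in> topspace (X a (Suc b))
      then fsum S (snd u) (map (\<lambda>m. signed S m (f (?t m u))) [0..<Suc b]) else undefined)"
    by (rule continuous_alternating_sum[OF Hausdorff_X Hausdorff_X local_homeo_snd local_homeo_snd])
      (auto intro!: local_homeo_reindex face_in_X(1)[OF _ set_del_at length_del_at]
        simp: fun_eq_iff in_topspace_X simp del: upt_Suc)
  moreover have "(\<lambda>f u. if u \<in> topspace (X a (Suc b))
      then fsum S (snd u) (map (\<lambda>m. signed S m (f (?t m u))) [0..<Suc b]) else undefined) = dT S (X a (Suc b))"
    by (auto simp: dT_def fun_eq_iff in_topspace_X simp del: upt_Suc)
  ultimately show "continuous_map (T (X a b) snd) (T (X a (Suc b)) snd) (dT S (X a (Suc b)))"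
    by simp
  have "continuous_map (T (X a b) snd) (T (X (Suc a) b) snd)
    (\<lambda>f u. if u \<in> topspace (X (Suc a) b)
      then fsum S (snd u) (map (\<lambda>m. signed S m (f (?s m u))) [0..<Suc a]) else undefined)"
    by (rule continuous_alternating_sum[OF Hausdorff_X Hausdorff_X local_homeo_snd local_homeo_snd])
      (auto intro!: local_homeo_reindex face_in_X(2)[OF _ set_del_at length_del_at]
        simp: fun_eq_iff in_topspace_X simp del: upt_Suc)
  moreover have "(\<lambda>f u. if u \<in> topspace (X (Suc a) b)
      then fsum S (snd u) (map (\<lambda>m. signed S m (f (?s m u))) [0..<Suc a]) else undefined) = dS S (X (Suc a) b)"
    by (auto simp: dS_def fun_eq_iff in_topspace_X simp del: upt_Suc)
  ultimately show "continuous_map (T (X a b) snd) (T (X (Suc a) b) snd) (dS S (X (Suc a) b))"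
    by simp
qed

lemma dT_sec: "f \<in> sec a b \<Longrightarrow> dT S (X a (Suc b)) f \<in> sec a (Suc b)"
  by (rule continuous_TX_closed[OF continuous_dT])

lemma dS_sec: "f \<in> sec a b \<Longrightarrow> dS S (X (Suc a) b) f \<in> sec (Suc a) b"
  by (rule continuous_TX_closed[OF continuous_dS])

text \<open>Extending cochains by zero makes them total functions into the stalk at \<open>x\<close>, so that the
  identities for \<open>cdiff\<close> apply without side conditions.\<close>

definition val :: "nat \<Rightarrow> nat \<Rightarrow> (('i list \<times> 'j list) \<times> 'a \<Rightarrow> 'e) \<Rightarrow> 'a \<Rightarrow> 'i list \<Rightarrow> 'j list \<Rightarrow> 'e" where
  "val a b f x s t = (if ((s, t), x) \<in> topspace (X a b) then f ((s, t), x) else szero S x)"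

lemma stalk_group: "((s, t), x) \<in> topspace (X a b) \<Longrightarrow> comm_group (stalk S x)"
  by (intro comm_group_stalk sheaf) (simp add: in_topspace_X)

lemma val_closed:
  assumes "f \<in> sec a b" "comm_group (stalk S x)"
  shows "val a b f x s t \<in> carrier (stalk S x)"
proof -
  interpret comm_group "stalk S x" by fact
  show ?thesis
    using sect_stalk[OF assms(1), of "((s, t), x)"] one_closed by (auto simp: val_def)
qed

text \<open>\<open>c\<close> stands for the raw values appearing in \<open>dT\<close> and
  \<open>dS\<close>, \<open>\<phi>\<close> for their total extension; agreement at the actual faces
  is enough.\<close>

lemma fsum_cdiff:
  assumes "x \<in> topspace (base S)" "\<And>t. \<phi> t \<in> carrier (stalk S x)"
    and "\<And>m. m < length t \<Longrightarrow> c m = \<phi> (del_at m t)"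
  shows "fsum S x (map (\<lambda>m. signed S m (c m)) [0..<length t]) = comm_group.cdiff (stalk S x) \<phi> t"
proof -
  interpret comm_group "stalk S x" using assms(1) by (rule comm_group_stalk[OF sheaf])
  have "map (\<lambda>m. signed S m (c m)) [0..<length t] =
      map (\<lambda>m. if even m then \<phi> (del_at m t) else inv\<^bsub>stalk S x\<^esub> (\<phi> (del_at m t))) [0..<length t]"
    using assms(3) by (auto simp: signed_def inv_stalk[OF sheaf assms(1) assms(2)])
  then show ?thesis
    using foldr_cdiff[of \<phi> t, OF assms(2)] by (simp only: fsum_def stalk_simps)
qed

lemma dT_eval:
  assumes "f \<in> sec a b" "((s, t), x) \<in> topspace (X a (Suc b))"
  shows "dT S (X a (Suc b)) f ((s, t), x) = comm_group.cdiff (stalk S x) (val a b f x s) t"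
proof -
  have "fsum S x (map (\<lambda>m. signed S m (f ((s, del_at m t), x))) [0..<length t])
      = comm_group.cdiff (stalk S x) (val a b f x s) t"
  proof (rule fsum_cdiff)
    show "x \<in> topspace (base S)" using assms(2) by (simp add: in_topspace_X)
    show "val a b f x s t' \<in> carrier (stalk S x)" for t'
      using val_closed[OF assms(1) stalk_group[OF assms(2)]] .
    show "f ((s, del_at m t), x) = val a b f x s (del_at m t)" if "m < length t" for m
      using face_in_X(1)[OF assms(2) set_del_at length_del_at[OF that]] by (simp add: val_def)
  qed
  then show ?thesis using assms(2) by (simp add: dT_def)
qed

lemma dS_eval:
  assumes "f \<in> sec a b" "((s, t), x) \<in> topspace (X (Suc a) b)"
  shows "dS S (X (Suc a) b) f ((s, t), x) = comm_group.cdiff (stalk S x) (\<lambda>s. val a b f x s t) s"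
proof -
  have "fsum S x (map (\<lambda>m. signed S m (f ((del_at m s, t), x))) [0..<length s])
      = comm_group.cdiff (stalk S x) (\<lambda>s. val a b f x s t) s"
  proof (rule fsum_cdiff)
    show "x \<in> topspace (base S)" using assms(2) by (simp add: in_topspace_X)
    show "val a b f x s' t \<in> carrier (stalk S x)" for s'
      using val_closed[OF assms(1) stalk_group[OF assms(2)]] .
    show "f ((del_at m s, t), x) = val a b f x (del_at m s) t" if "m < length s" for m
      using face_in_X(2)[OF assms(2) set_del_at length_del_at[OF that]] by (simp add: val_def)
  qed
  then show ?thesis using assms(2) by (simp add: dS_def)
qed

section \<open>The identities of the double complex\<close>

lemma dT_hom: "dT S (X a (Suc b)) \<in> hom (sections S (X a b) snd) (sections S (X a (Suc b)) snd)"
proof (rule homI, unfold sections_simps)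
  fix f g assume fg: "f \<in> sec a b" "g \<in> sec a b"
  note closed = sec_ops_closed[OF Hausdorff_X local_homeo_snd]
  show "dT S (X a (Suc b)) (sec_add S (X a b) f g)
    = sec_add S (X a (Suc b)) (dT S (X a (Suc b)) f) (dT S (X a (Suc b)) g)"
  proof (rule sect_eqI[of _ S "X a (Suc b)" snd])
    fix u assume u: "u \<in> topspace (X a (Suc b))"
    obtain s t x where ueq: "u = ((s, t), x)" by (metis surj_pair)
    note u' = u[unfolded ueq]
    interpret comm_group "stalk S x" using stalk_group[OF u'] .
    have v: "val a b f x s t' \<in> carrier (stalk S x)" "val a b g x s t' \<in> carrier (stalk S x)" for t'
      using fg val_closed comm_group_axioms by auto
    \<comment> \<open>At invalid indices both sides are the default zero, because zero plus zero is
      zero.\<close>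
    have "val a b (sec_add S (X a b) f g) x s = (\<lambda>t. val a b f x s t \<otimes>\<^bsub>stalk S x\<^esub> val a b g x s t)"
      using l_one[OF one_closed] by (auto simp: val_def sec_add_def fun_eq_iff)
    then show "dT S (X a (Suc b)) (sec_add S (X a b) f g) u
      = sec_add S (X a (Suc b)) (dT S (X a (Suc b)) f) (dT S (X a (Suc b)) g) u"
      using cdiff_mult[of "val a b f x s" "val a b g x s" t, OF v] u'
      by (simp add: ueq dT_eval closed fg) (simp add: dT_eval fg sec_add_def)
  qed (auto intro!: dT_sec closed fg)
qed (rule dT_sec)

lemma dS_hom: "dS S (X (Suc a) b) \<in> hom (sections S (X a b) snd) (sections S (X (Suc a) b) snd)"
proof (rule homI, unfold sections_simps)
  fix f g assume fg: "f \<in> sec a b" "g \<in> sec a b"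
  note closed = sec_ops_closed[OF Hausdorff_X local_homeo_snd]
  show "dS S (X (Suc a) b) (sec_add S (X a b) f g)
    = sec_add S (X (Suc a) b) (dS S (X (Suc a) b) f) (dS S (X (Suc a) b) g)"
  proof (rule sect_eqI[of _ S "X (Suc a) b" snd])
    fix u assume u: "u \<in> topspace (X (Suc a) b)"
    obtain s t x where ueq: "u = ((s, t), x)" by (metis surj_pair)
    note u' = u[unfolded ueq]
    interpret comm_group "stalk S x" using stalk_group[OF u'] .
    have v: "val a b f x s' t \<in> carrier (stalk S x)" "val a b g x s' t \<in> carrier (stalk S x)" for s'
      using fg val_closed comm_group_axioms by auto
    have "(\<lambda>s. val a b (sec_add S (X a b) f g) x s t)
        = (\<lambda>s. val a b f x s t \<otimes>\<^bsub>stalk S x\<^esub> val a b g x s t)"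
      using l_one[OF one_closed] by (auto simp: val_def sec_add_def fun_eq_iff)
    then show "dS S (X (Suc a) b) (sec_add S (X a b) f g) u
      = sec_add S (X (Suc a) b) (dS S (X (Suc a) b) f) (dS S (X (Suc a) b) g) u"
      using cdiff_mult[of "\<lambda>s. val a b f x s t" "\<lambda>s. val a b g x s t" s, OF v] u'
      by (simp add: ueq dS_eval closed fg) (simp add: dS_eval fg sec_add_def)
  qed (auto intro!: dS_sec closed fg)
qed (rule dS_sec)

text \<open>Extending by zero need not commute with taking face sums: a tuple with an invalid entry
  can have a valid face. Both agree on the faces of a valid tuple, so \<open>cdiff_cong\<close>
  suffices.\<close>

lemma cdiff_val_dT:
  assumes "f \<in> sec a b" "((s, t), x) \<in> topspace (X a (Suc (Suc b)))"
  shows "comm_group.cdiff (stalk S x) (val a (Suc b) (dT S (X a (Suc b)) f) x s) t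
    = comm_group.cdiff (stalk S x) (comm_group.cdiff (stalk S x) (val a b f x s)) t"
  using assms
  by (intro comm_group.cdiff_cong stalk_group[OF assms(2)]) (simp add: val_def dT_eval face_in_X(1))

lemma dT_dT:
  assumes "f \<in> sec a b"
  shows "dT S (X a (Suc (Suc b))) (dT S (X a (Suc b)) f) = sec_zero S (X a (Suc (Suc b))) snd"
proof (rule sect_eqI[of _ S "X a (Suc (Suc b))" snd])
  fix u assume u: "u \<in> topspace (X a (Suc (Suc b)))"
  obtain s t x where ueq: "u = ((s, t), x)" by (metis surj_pair)
  note u' = u[unfolded ueq]
  interpret comm_group "stalk S x" using stalk_group[OF u'] .
  have "dT S (X a (Suc (Suc b))) (dT S (X a (Suc b)) f) u = cdiff (cdiff (val a b f x s)) t"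
    using assms u' by (simp add: ueq dT_eval dT_sec cdiff_val_dT)
  also have "\<dots> = szero S x"
    using cdiff_cdiff[of "val a b f x s" t] val_closed[OF assms comm_group_axioms] by simp
  finally show "dT S (X a (Suc (Suc b))) (dT S (X a (Suc b)) f) u = sec_zero S (X a (Suc (Suc b))) snd u"
    using u by (simp add: ueq sec_zero_def)
qed (auto intro!: dT_sec assms sec_zero_in_sect local_homeo_snd)

lemma dS_dS:
  assumes "f \<in> sec a b"
  shows "dS S (X (Suc (Suc a)) b) (dS S (X (Suc a) b) f) = sec_zero S (X (Suc (Suc a)) b) snd"
proof (rule sect_eqI[of _ S "X (Suc (Suc a)) b" snd])
  fix u assume u: "u \<in> topspace (X (Suc (Suc a)) b)"
  obtain s t x where ueq: "u = ((s, t), x)" by (metis surj_pair)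
  note u' = u[unfolded ueq]
  interpret comm_group "stalk S x" using stalk_group[OF u'] .
  have "dS S (X (Suc (Suc a)) b) (dS S (X (Suc a) b) f) u
      = cdiff (\<lambda>s. val (Suc a) b (dS S (X (Suc a) b) f) x s t) s"
    using assms u' by (simp add: ueq dS_eval dS_sec)
  also have "\<dots> = cdiff (cdiff (\<lambda>s. val a b f x s t)) s"
    using assms u' by (intro cdiff_cong) (simp add: val_def dS_eval face_in_X(2))
  also have "\<dots> = szero S x"
    using cdiff_cdiff[of "\<lambda>s. val a b f x s t" s] val_closed[OF assms comm_group_axioms] by simp
  finally show "dS S (X (Suc (Suc a)) b) (dS S (X (Suc a) b) f) u = sec_zero S (X (Suc (Suc a)) b) snd u"
    using u by (simp add: ueq sec_zero_def)
qed (auto intro!: dS_sec assms sec_zero_in_sect local_homeo_snd)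

lemma dT_dS:
  assumes "f \<in> sec a b"
  shows "dT S (X (Suc a) (Suc b)) (dS S (X (Suc a) b) f) = dS S (X (Suc a) (Suc b)) (dT S (X a (Suc b)) f)"
proof (rule sect_eqI[of _ S "X (Suc a) (Suc b)" snd])
  fix u assume u: "u \<in> topspace (X (Suc a) (Suc b))"
  obtain s t x where ueq: "u = ((s, t), x)" by (metis surj_pair)
  note u' = u[unfolded ueq]
  interpret comm_group "stalk S x" using stalk_group[OF u'] .
  have "dT S (X (Suc a) (Suc b)) (dS S (X (Suc a) b) f) u
      = cdiff (val (Suc a) b (dS S (X (Suc a) b) f) x s) t"
    using assms u' by (simp add: ueq dT_eval dS_sec)
  also have "\<dots> = cdiff (\<lambda>t. cdiff (\<lambda>s. val a b f x s t) s) t"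
    using assms u' by (intro cdiff_cong) (simp add: val_def dS_eval face_in_X(1))
  also have "\<dots> = cdiff (\<lambda>s. cdiff (val a b f x s) t) s"
    using cdiff_commute[of "val a b f x" t s] val_closed[OF assms comm_group_axioms] by simp
  also have "\<dots> = cdiff (\<lambda>s. val a (Suc b) (dT S (X a (Suc b)) f) x s t) s"
    using assms u' by (intro cdiff_cong) (simp add: val_def dT_eval face_in_X(2))
  also have "\<dots> = dS S (X (Suc a) (Suc b)) (dT S (X a (Suc b)) f) u"
    using assms u' by (simp add: ueq dS_eval dT_sec)
  finally show "dT S (X (Suc a) (Suc b)) (dS S (X (Suc a) b) f) u
      = dS S (X (Suc a) (Suc b)) (dT S (X a (Suc b)) f) u" .
qed (auto intro!: dT_sec dS_sec assms)

text \<open>The augmentation is injective because \<open>V\<close> covers: near a point of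
  \<open>V j\<close>, the component of \<open>dT f\<close> at \<open>[j]\<close> is \<open>f\<close>
  itself.\<close>

lemma dT_injective:
  assumes "f \<in> sec a 0" "dT S (X a (Suc 0)) f = sec_zero S (X a (Suc 0)) snd"
  shows "f = sec_zero S (X a 0) snd"
proof (rule sect_eqI[OF assms(1) sec_zero_in_sect[OF local_homeo_snd]])
  fix u assume u: "u \<in> topspace (X a 0)"
  obtain s t x where ueq: "u = ((s, t), x)" by (metis surj_pair)
  note u' = u[unfolded ueq]
  interpret comm_group "stalk S x" using stalk_group[OF u'] .
  have t: "t = []" and x: "x \<in> topspace (base S)" using u' by (auto simp: in_topspace_X)
  obtain j where j: "j \<in> J" "x \<in> V j" using x cover_V by (auto simp: open_cover_def)
  have uj: "((s, [j]), x) \<in> topspace (X a (Suc 0))" using u' j by (simp add: in_topspace_X)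
  have "val a 0 f x s [] \<in> carrier (stalk S x)"
    using val_closed[OF assms(1) comm_group_axioms] .
  then have "val a 0 f x s [] = dT S (X a (Suc 0)) f ((s, [j]), x)"
    using dT_eval[OF assms(1) uj] r_one by (simp add: inv_one[simplified])
  then show "f u = sec_zero S (X a 0) snd u"
    using u' uj by (simp add: assms(2) sec_zero_def val_def ueq t)
qed

text \<open>The Alexander--Whitney map written as a pullback, which makes it a continuous
  homomorphism at once. The front has \<open>Suc k\<close> and the back \<open>Suc b\<close>
  entries; they share one, so the tuple has \<open>Suc (k + b)\<close>.\<close>

definition aw_pullback :: "nat \<Rightarrow> nat \<Rightarrow> (('i list \<times> 'j list) \<times> 'a \<Rightarrow> 'e) \<Rightarrow> ('i list \<times> 'j list) \<times> 'a \<Rightarrow> 'e" where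
  "aw_pullback k b f =
     restrict (f \<circ> apfst (\<lambda>(s, t). (map \<tau> (take (Suc k) t), drop k t))) (topspace (X 0 (Suc (k + b))))"

lemma refined_in_X: "((s, t), x) \<in> topspace (X 0 a) \<Longrightarrow> ((map \<tau> t, []), x) \<in> topspace (X a 0)"
  using refines by (fastforce simp: in_topspace_X)

lemma aw_in_X:
  "((s, t), x) \<in> topspace (X 0 (Suc (k + b))) \<Longrightarrow>
    ((map \<tau> (take (Suc k) t), drop k t), x) \<in> topspace (X (Suc k) (Suc b))"
  using refines by (fastforce simp: in_topspace_X dest: in_set_takeD in_set_dropD)

lemma refine_eq:
  "refine \<tau> (X 0 a) = (\<lambda>f. restrict (f \<circ> apfst (\<lambda>(s, t). (map \<tau> t, []))) (topspace (X 0 a)))"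
  by (auto simp: refine_def fun_eq_iff)

lemma refine_hom: "refine \<tau> (X 0 a) \<in> hom (sections S (X a 0) snd) (sections S (X 0 a) snd)"
  unfolding refine_eq by (rule reindex_hom) (auto intro: refined_in_X)

lemma aw_hom: "aw_pullback k b \<in> hom (sections S (X (Suc k) (Suc b)) snd) (sections S (X 0 (Suc (k + b))) snd)"
  unfolding aw_pullback_def[abs_def] by (rule reindex_hom) (auto intro: aw_in_X)

lemma aw_continuous:
  "continuous_map (T (X (Suc k) (Suc b)) snd) (T (X 0 (Suc (k + b))) snd) (aw_pullback k b)"
  unfolding aw_pullback_def[abs_def] by (rule continuous_reindex) (auto intro: aw_in_X)

lemma refine_sec: "f \<in> sec a 0 \<Longrightarrow> refine \<tau> (X 0 a) f \<in> sec 0 a"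
  using hom_in_carrier[OF refine_hom] by simp

lemma aw_sec: "f \<in> sec (Suc k) (Suc b) \<Longrightarrow> aw_pullback k b f \<in> sec 0 (Suc (k + b))"
  using hom_in_carrier[OF aw_hom] by simp

lemma dT_refine:
  assumes "f \<in> sec a 0"
  shows "dT S (X 0 (Suc a)) (refine \<tau> (X 0 a) f) = refine \<tau> (X 0 (Suc a)) (dS S (X (Suc a) 0) f)"
proof (rule sect_eqI[of _ S "X 0 (Suc a)" snd])
  fix u assume u: "u \<in> topspace (X 0 (Suc a))"
  obtain s t x where ueq: "u = ((s, t), x)" by (metis surj_pair)
  note u' = u[unfolded ueq]
  interpret comm_group "stalk S x" using stalk_group[OF u'] .
  have "dT S (X 0 (Suc a)) (refine \<tau> (X 0 a) f) u = cdiff (val 0 a (refine \<tau> (X 0 a) f) x s) t"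
    using assms u' by (simp add: ueq dT_eval refine_sec)
  also have "\<dots> = cdiff (\<lambda>t. val a 0 f x (map \<tau> t) []) t"
    using assms u' refined_in_X[of s _ x a]
    by (intro cdiff_cong) (simp add: val_def refine_def face_in_X(1))
  also have "\<dots> = cdiff (\<lambda>s. val a 0 f x s []) (map \<tau> t)"
    by (simp add: cdiff_map)
  also have "\<dots> = refine \<tau> (X 0 (Suc a)) (dS S (X (Suc a) 0) f) u"
    using assms u' by (simp add: ueq refine_def dS_eval refined_in_X)
  finally show "dT S (X 0 (Suc a)) (refine \<tau> (X 0 a) f) u
    = refine \<tau> (X 0 (Suc a)) (dS S (X (Suc a) 0) f) u" .
qed (auto intro!: dT_sec refine_sec dS_sec assms)

lemma aw_dT_0:
  assumes "f \<in> sec (Suc k) 0"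
  shows "aw_pullback k 0 (dT S (X (Suc k) (Suc 0)) f) = refine \<tau> (X 0 (Suc k)) f"
proof (rule sect_eqI[of _ S "X 0 (Suc k)" snd])
  fix u assume u: "u \<in> topspace (X 0 (Suc k))"
  obtain s t x where ueq: "u = ((s, t), x)" by (metis surj_pair)
  note u' = u[unfolded ueq]
  interpret comm_group "stalk S x" using stalk_group[OF u'] .
  have len: "length t = Suc k" using u' by (simp add: in_topspace_X)
  \<comment> \<open>The back piece is a single index, whose only face is the empty tuple, so
    \<open>dT f\<close> there returns the value of \<open>f\<close>.\<close>
  then obtain j where j: "drop k t = [j]"
    by (metis Cons_nth_drop_Suc drop_all lessI order_refl)
  have v: "val (Suc k) 0 f x (map \<tau> t) [] \<in> carrier (stalk S x)"
    using val_closed[OF assms comm_group_axioms] .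
  show "aw_pullback k 0 (dT S (X (Suc k) (Suc 0)) f) u = refine \<tau> (X 0 (Suc k)) f u"
    using u' aw_in_X[of s t x k 0] refined_in_X[OF u'] dT_eval[OF assms, of "map \<tau> t" "drop k t" x] r_one[OF v]
    by (simp add: ueq aw_pullback_def refine_def len j inv_one[simplified] val_def)
qed (use aw_sec[of _ k 0] in \<open>auto intro!: dT_sec refine_sec assms\<close>)

lemma aw_0_dS:
  assumes "f \<in> sec 0 (Suc b)"
  shows "aw_pullback 0 b (dS S (X (Suc 0) (Suc b)) f) = f"
proof (rule sect_eqI[OF _ assms])
  fix u assume u: "u \<in> topspace (X 0 (Suc b))"
  obtain s t x where ueq: "u = ((s, t), x)" by (metis surj_pair)
  note u' = u[unfolded ueq]
  interpret comm_group "stalk S x" using stalk_group[OF u'] .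
  have s: "s = []" and "length t = Suc b" using u' by (auto simp: in_topspace_X)
  then obtain j t' where t: "t = j # t'" by (cases t) auto
  have v: "val 0 (Suc b) f x [] t \<in> carrier (stalk S x)"
    using val_closed[OF assms comm_group_axioms] .
  show "aw_pullback 0 b (dS S (X (Suc 0) (Suc b)) f) u = f u"
    \<comment> \<open>Dually, the front piece is the single index \<open>\<tau> j\<close>, whose
      only face is empty.\<close>
    using u' aw_in_X[of s t x 0 b] dS_eval[OF assms, of "[\<tau> j]" t x] r_one[OF v]
    by (simp add: ueq aw_pullback_def s t inv_one[simplified] val_def)
qed (use aw_sec[of _ 0 b] in \<open>auto intro!: dS_sec assms\<close>)

text \<open>At a point of the base this is \<open>cdiff_aw\<close> in the stalk, applied to the zero
  extension of \<open>f\<close>; the remaining work identifies the three terms with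
  sections.\<close>

lemma dT_aw:
  assumes "f \<in> sec (Suc k) (Suc b)"
  shows "dT S (X 0 (Suc (Suc (k + b)))) (aw_pullback k b f) =
    sec_add S (X 0 (Suc (Suc (k + b)))) (aw_pullback (Suc k) b (dS S (X (Suc (Suc k)) (Suc b)) f))
      (if even k then aw_pullback k (Suc b) (dT S (X (Suc k) (Suc (Suc b))) f)
       else sec_neg S (X 0 (Suc (Suc (k + b)))) (aw_pullback k (Suc b) (dT S (X (Suc k) (Suc (Suc b))) f)))"
    (is "?l = sec_add S _ ?p (if _ then ?q else _)")
proof (rule sect_eqI[of _ S "X 0 (Suc (Suc (k + b)))" snd])
  have p: "?p \<in> sec 0 (Suc (Suc (k + b)))" and q: "?q \<in> sec 0 (Suc (Suc (k + b)))"
    using aw_sec[OF dS_sec[OF assms]] aw_sec[OF dT_sec[OF assms]] by simp_all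
  then show "sec_add S (X 0 (Suc (Suc (k + b)))) ?p
      (if even k then ?q else sec_neg S (X 0 (Suc (Suc (k + b)))) ?q) \<in> sec 0 (Suc (Suc (k + b)))"
    by (auto intro!: sec_ops_closed Hausdorff_X local_homeo_snd)
  show "?l \<in> sec 0 (Suc (Suc (k + b)))"
    using assms by (intro dT_sec aw_sec)
  fix u assume u: "u \<in> topspace (X 0 (Suc (Suc (k + b))))"
  obtain s t x where ueq: "u = ((s, t), x)" by (metis surj_pair)
  note u' = u[unfolded ueq]
  interpret comm_group "stalk S x" using stalk_group[OF u'] .
  have len: "length t = Suc (Suc (k + b))" and x: "x \<in> topspace (base S)"
    using u' by (auto simp: in_topspace_X)
  let ?h = "val (Suc k) (Suc b) f x"
  have h: "?h s t \<in> carrier (stalk S x)" for s t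
    using val_closed[OF assms comm_group_axioms] .
  have "?l u = cdiff (val 0 (Suc (k + b)) (aw_pullback k b f) x s) t"
    using assms u' by (simp add: ueq dT_eval aw_sec)
  also have "\<dots> = cdiff (aw \<tau> k ?h) t"
    using u' aw_in_X[of s _ x k b]
    by (intro cdiff_cong) (simp add: val_def aw_pullback_def aw_def face_in_X(1))
  also have "\<dots> = sadd S (aw \<tau> (Suc k) (\<lambda>s t. cdiff (\<lambda>s. ?h s t) s) t)
      (if even k then aw \<tau> k (\<lambda>s. cdiff (?h s)) t else inv\<^bsub>stalk S x\<^esub> (aw \<tau> k (\<lambda>s. cdiff (?h s)) t))"
    using cdiff_aw[of ?h k t \<tau>, OF h] len by simp
  also have "aw \<tau> (Suc k) (\<lambda>s t. cdiff (\<lambda>s. ?h s t) s) t = ?p u"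
    using u' assms aw_in_X[of s t x "Suc k" b] by (simp add: ueq aw_pullback_def aw_def dS_eval)
  also have "aw \<tau> k (\<lambda>s. cdiff (?h s)) t = ?q u"
    using u' assms aw_in_X[of s t x k "Suc b"] by (simp add: ueq aw_pullback_def aw_def dT_eval)
  also have "inv\<^bsub>stalk S x\<^esub> (?q u) = sneg S (?q u)"
    using inv_stalk[OF sheaf x] sect_stalk[OF q u] by (simp add: ueq)
  finally show "?l u = sec_add S (X 0 (Suc (Suc (k + b)))) ?p
      (if even k then ?q else sec_neg S (X 0 (Suc (Suc (k + b)))) ?q) u"
    using u by (simp add: sec_add_def sec_neg_def)
qed

end

theorem theorem2p2:
  fixes S :: "('a, 'e) ab_sheaf"
    and T :: "(('i list \<times> 'j list) \<times> 'a) topology \<Rightarrow> ((('i list \<times> 'j list) \<times> 'a) \<Rightarrow> 'a)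
              \<Rightarrow> ((('i list \<times> 'j list) \<times> 'a) \<Rightarrow> 'e) topology"
    and I :: "'i set" and U :: "'i \<Rightarrow> 'a set"
    and J :: "'j set" and V :: "'j \<Rightarrow> 'a set"
    and \<tau> :: "'j \<Rightarrow> 'i" and n :: nat
  assumes "Hausdorff_space (base S)"
    and "is_ab_sheaf S"
    and "topologized S T"
    and "open_cover (base S) I U"
    and "open_cover (base S) J V"
    and "\<forall>j\<in>J. \<tau> j \<in> I \<and> V j \<subseteq> U (\<tau> j)"
    and "\<forall>p q. open_map (T (cech_space (base S) I U J V (Suc p) q) snd)
                (subtopology (T (cech_space (base S) I U J V (Suc p) (Suc q)) snd)
                   (ZT S I U J V (Suc p) (Suc q)))
                (dT S (cech_space (base S) I U J V (Suc p) (Suc q)))"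
  shows "open_map
           (prod_topology
              (subtopology (T (cech_space (base S) I U J V (Suc n) 0) snd) (ZS S I U J V (Suc n) 0))
              (T (cech_space (base S) I U J V 0 n) snd))
           (subtopology (T (cech_space (base S) I U J V 0 (Suc n)) snd) (ZT S I U J V 0 (Suc n)))
           (\<lambda>(f, g). sec_add S (cech_space (base S) I U J V 0 (Suc n))
                       (refine \<tau> (cech_space (base S) I U J V 0 (Suc n)) f)
                       (dT S (cech_space (base S) I U J V 0 (Suc n)) g))"
proof -
  interpret cech_covers S T I U J V \<tau>
    using assms by unfold_locales auto
  \<comment> \<open>The Cech data instantiate the abstract complex, each differential being indexed
    by its source while \<open>dT S\<close> and \<open>dS S\<close> take the target space.\<close>
  interpret augmented_double_complex "\<lambda>a b. sections S (X a b) snd" "\<lambda>a b. T (X a b) snd"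
    "\<lambda>a b. dT S (X a (Suc b))" "\<lambda>a b. dS S (X (Suc a) b)" aw_pullback "\<lambda>a. refine \<tau> (X 0 a)"
  proof (unfold_locales, unfold sections_simps)
    fix p q
    show "open_map (T (X (Suc p) q) snd)
      (subtopology (T (X (Suc p) (Suc q)) snd)
        {f \<in> sec (Suc p) (Suc q). dT S (X (Suc p) (Suc (Suc q))) f = sec_zero S (X (Suc p) (Suc (Suc q))) snd})
      (dT S (X (Suc p) (Suc q)))"
      using assms(7) by (simp add: ZT_def)
  next
    fix f k b assume f: "f \<in> sec (Suc k) (Suc b)"
    \<comment> \<open>Membership is needed to identify the abstract group inverse in
      \<open>dT_P\<close> with \<open>sec_neg\<close>.\<close>
    have "aw_pullback k (Suc b) (dT S (X (Suc k) (Suc (Suc b))) f) \<in> sec 0 (Suc (Suc (k + b)))"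
      using aw_sec[OF dT_sec[OF f]] by simp
    then show "dT S (X 0 (Suc (Suc (k + b)))) (aw_pullback k b f) =
      sec_add S (X 0 (Suc (Suc (k + b)))) (aw_pullback (Suc k) b (dS S (X (Suc (Suc k)) (Suc b)) f))
      (if even k then aw_pullback k (Suc b) (dT S (X (Suc k) (Suc (Suc b))) f)
       else inv\<^bsub>sections S (X 0 (Suc (Suc (k + b)))) snd\<^esub>
         aw_pullback k (Suc b) (dT S (X (Suc k) (Suc (Suc b))) f))"
      using dT_aw[OF f] by (simp add: inv_sections Hausdorff_X local_homeo_snd)
  qed (fact top_ab_group_sections[OF Hausdorff_X local_homeo_snd] dT_hom dS_hom refine_hom aw_hom
      continuous_dS aw_continuous dT_dT dS_dS dT_dS dT_refine aw_dT_0 aw_0_dS dT_injective)+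
  show ?thesis
    using refinement_open_map[of n] by (simp add: ZT_def ZS_def)
qed

end
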